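(* Let $f:[0,1]\to\mathbb{R}_+$ be a continuous function with $f(0)=f(1)=0$ whose local minima are distinct, meaning that if $0\le a<b<c<d\le1$ are such that the infimum of $f$ over $]a,b[$ is attained at a point of $]a,b[$ and the infimum of $f$ over $]c,d[$ is attained at a point of $]c,d[$, then $\min_{]a,b[}f\ne\min_{]c,d[}f$. For every $n\ge1$, let $\theta_n$ be a noncrossing tree with $n$ vertices and let $\tau_n$ be its shape. Assume that, as $n\to\infty$, (i) $\mathsf{H}(\tau_n)/n\to0$; (ii) there exists a sequence $B_n\to\infty$ such that $\mathcal{W}(\tau_n)/B_n\to f$ for the uniform topology, i.e. the functions $s\mapsto\mathcal{W}_{\lfloor ns\rfloor}(\tau_n)/B_n$ converge to $f$ uniformly on $[0,1]$. Then the convergence $\theta_n\to\mathbf{L}(f)$ holds for the Hausdorff topology on compact subsets of the closed unit disk.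
   Context: **Noncrossing trees and shapes.** A noncrossing tree with $n$ vertices is a tree drawn in the closed unit disk whose vertices are the $n$-th roots of unity and whose edges are straight line segments which do not cross (distinct edges may only meet at a common endpoint). It is viewed as a compact subset of the disk (the union of its edges). Its shape is the plane (rooted ordered) tree it carries, rooted at the vertex $1\in\mathbb{C}$; explicitly, giving the vertex $e^{-2i\pi p/n}$ the label $p\in\{0,\dots,n-1\}$, the children of each vertex are ordered by increasing label. **Plane trees.** For a plane tree $\tau$, $|u|$ is the generation (distance to the root) of $u$, $k_u(\tau)$ its number of children, and $\mathsf{H}(\tau)=\max_{u\in\tau}|u|$ is the height. If $u(0)\prec u(1)\prec\dots\prec u(n-1)$ are the $n$ vertices of $\tau$ in lexicographical (depth-first) order, the Łukasiewicz path $\mathcal{W}(\tau)$ is given by $\mathcal{W}_0(\tau)=0$ and $\mathcal{W}_{j+1}(\tau)=\mathcal{W}_j(\tau)+k_{u(j)}(\tau)-1$ for $0\le j\le n-1$. **Triangulation coded by $f$.** Write $s\sim_f t$ if $f(s)=f(t)=\min_{[s\wedge t,s\vee t]}f$. Then $\mathbf{L}(f)=\bigcup_{s\sim_f t}[e^{-2i\pi s},e^{-2i\pi t}]$. *)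

theory Defs
  imports "HOL-Analysis.Analysis" "HOL-Library.List_Lexorder"
begin

section \<open>The Hausdorff topology on nonempty compact sets\<close>

text \<open>The value 0 outside nonempty bounded sets is a dummy: the locale \<^locale>\<open>Metric_space\<close>
  requires distances to be nonnegative outside the carrier too.\<close>

definition hausdorff_dist :: "'a::metric_space set \<Rightarrow> 'a set \<Rightarrow> real" where
  "hausdorff_dist A B =
     (if A \<noteq> {} \<and> B \<noteq> {} \<and> bounded A \<and> bounded B
      then max (SUP x\<in>A. infdist x B) (SUP y\<in>B. infdist y A) else 0)"

definition compacts_in :: "'a::metric_space set \<Rightarrow> 'a set set" where
  "compacts_in D = {K. compact K \<and> K \<noteq> {} \<and> K \<subseteq> D}"

definition hausdorff_topology :: "'a::metric_space set \<Rightarrow> 'a set topology" where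
  "hausdorff_topology D = Metric_space.mtopology (compacts_in D) hausdorff_dist"

lemma bdd_above_infdist:
  assumes "bounded S"
  shows "bdd_above ((\<lambda>x. infdist x T) ` S)"
proof (cases "T = {}")
  case False
  then obtain t where t: "t \<in> T" by blast
  from assms obtain e where e: "\<forall>x\<in>S. dist t x \<le> e" using bounded_any_center by blast
  have "infdist x T \<le> e" if "x \<in> S" for x
    using infdist_le2[OF t, of x e] e that by (simp add: dist_commute)
  then show ?thesis by (meson bdd_aboveI2)
qed (simp add: infdist_def image_constant_conv)

lemma hausdorff_dist_le_iff:
  assumes "bounded A" "A \<noteq> {}" "bounded B" "B \<noteq> {}"
  shows "hausdorff_dist A B \<le> r \<longleftrightarrow> (\<forall>x\<in>A. infdist x B \<le> r) \<and> (\<forall>y\<in>B. infdist y A \<le> r)"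
  using assms by (simp add: hausdorff_dist_def cSUP_le_iff bdd_above_infdist)

lemma hausdorff_dist_nonneg: "0 \<le> hausdorff_dist A B"
proof (cases "A \<noteq> {} \<and> B \<noteq> {} \<and> bounded A \<and> bounded B")
  case True
  then obtain x where "x \<in> A" by blast
  then have "infdist x B \<le> hausdorff_dist A B"
    using hausdorff_dist_le_iff[of A B "hausdorff_dist A B"] True by blast
  then show ?thesis using infdist_nonneg[of x B] by linarith
qed (auto simp: hausdorff_dist_def)

lemma hausdorff_dist_commute: "hausdorff_dist A B = hausdorff_dist B A"
  by (auto simp: hausdorff_dist_def max.commute)

lemma Metric_space_hausdorff: "Metric_space (compacts_in D) hausdorff_dist"
proof
  fix A B assume "A \<in> compacts_in D" "B \<in> compacts_in D"
  then have AB: "compact A" "A \<noteq> {}" "compact B" "B \<noteq> {}" by (auto simp: compacts_in_def)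
  show "hausdorff_dist A B = 0 \<longleftrightarrow> A = B"
  proof
    assume "hausdorff_dist A B = 0"
    then have "(\<forall>x\<in>A. infdist x B \<le> 0) \<and> (\<forall>y\<in>B. infdist y A \<le> 0)"
      using AB hausdorff_dist_le_iff[of A B 0] by (auto simp: compact_imp_bounded)
    then have "(\<forall>x\<in>A. infdist x B = 0) \<and> (\<forall>y\<in>B. infdist y A = 0)"
      by (meson antisym infdist_nonneg)
    then show "A = B"
      using AB in_closed_iff_infdist_zero[of A] in_closed_iff_infdist_zero[of B]
      by (auto simp: compact_imp_closed)
  next
    assume "A = B"
    then have "hausdorff_dist A B \<le> 0"
      using AB by (subst hausdorff_dist_le_iff) (auto simp: compact_imp_bounded)
    then show "hausdorff_dist A B = 0" using hausdorff_dist_nonneg[of A B] by linarith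
  qed
next
  fix A B C assume "A \<in> compacts_in D" "B \<in> compacts_in D" "C \<in> compacts_in D"
  then have ABC: "compact A" "A \<noteq> {}" "compact B" "B \<noteq> {}" "compact C" "C \<noteq> {}"
    by (auto simp: compacts_in_def)
  have *: "infdist x T \<le> hausdorff_dist S U + hausdorff_dist U T"
    if "x \<in> S" "compact S" "compact U" "U \<noteq> {}" "compact T" "T \<noteq> {}" for x S U T
  proof -
    have U: "compact U" "U \<noteq> {}" using that by auto
    have S: "S \<noteq> {}" using that by blast
    obtain y where y: "y \<in> U" "\<forall>z\<in>U. dist x y \<le> dist x z"
      using continuous_attains_inf[OF U continuous_on_dist[OF continuous_on_const continuous_on_id]]
      by blast
    have "dist x y \<le> infdist x U"
      using y(2) U(2) by (simp add: infdist_notempty cINF_greatest)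
    moreover have "infdist x T \<le> infdist y T + dist x y" by (rule infdist_triangle)
    moreover have "infdist y T \<le> hausdorff_dist U T"
      using hausdorff_dist_le_iff[of U T "hausdorff_dist U T"] that y
      by (simp add: compact_imp_bounded)
    moreover have "infdist x U \<le> hausdorff_dist S U"
      using hausdorff_dist_le_iff[of S U "hausdorff_dist S U"] that S
      by (simp add: compact_imp_bounded)
    ultimately show ?thesis using y by linarith
  qed
  show "hausdorff_dist A C \<le> hausdorff_dist A B + hausdorff_dist B C"
    using ABC *[of _ A B C] *[of _ C B A]
    by (subst hausdorff_dist_le_iff)
       (auto simp: compact_imp_bounded hausdorff_dist_commute add.commute)
qed (simp_all add: hausdorff_dist_nonneg hausdorff_dist_commute)

lemma limitin_hausdorff_topology:
  "limitin (hausdorff_topology D) K L F \<longleftrightarrow>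
     L \<in> compacts_in D \<and> (\<forall>\<^sub>F n in F. K n \<in> compacts_in D) \<and>
     ((\<lambda>n. hausdorff_dist (K n) L) \<longlongrightarrow> 0) F"
  unfolding hausdorff_topology_def
  by (rule Metric_space.limitin_metric_dist_null[OF Metric_space_hausdorff])


section \<open>Plane trees\<close>

text \<open>A plane tree is a finite set of words (Neveu's formalism, with letters starting at 0): the
  word \<open>[]\<close> is the root and \<open>u @ [i]\<close> is the \<open>(i + 1)\<close>-st child of \<open>u\<close>.\<close>

definition plane_tree :: "nat list set \<Rightarrow> bool" where
  "plane_tree \<tau> \<longleftrightarrow> finite \<tau> \<and> [] \<in> \<tau> \<and>
     (\<forall>u i. u @ [i] \<in> \<tau> \<longrightarrow> u \<in> \<tau> \<and> (\<forall>j\<le>i. u @ [j] \<in> \<tau>))"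

definition num_children :: "nat list set \<Rightarrow> nat list \<Rightarrow> nat" where
  "num_children \<tau> u = card {i. u @ [i] \<in> \<tau>}"

definition height :: "nat list set \<Rightarrow> nat" where
  "height \<tau> = Max (length ` \<tau>)"

text \<open>The order on words here is the lexicographical one, in which prefixes come first.\<close>

definition dfs_vertex :: "nat list set \<Rightarrow> nat \<Rightarrow> nat list" where
  "dfs_vertex \<tau> j = sorted_list_of_set \<tau> ! j"

primrec lukasiewicz :: "nat list set \<Rightarrow> nat \<Rightarrow> int" where
  "lukasiewicz \<tau> 0 = 0"
| "lukasiewicz \<tau> (Suc j) = lukasiewicz \<tau> j + int (num_children \<tau> (dfs_vertex \<tau> j)) - 1"


section \<open>Noncrossing trees\<close>

text \<open>A noncrossing tree with \<open>n\<close> vertices is given by its set \<open>E\<close> of edges \<open>{p, q}\<close>, where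
  \<open>p, q < n\<close> are the labels of the endpoints.\<close>

definition circ :: "real \<Rightarrow> complex" where
  "circ s = exp (- 2 * \<i> * of_real pi * of_real s)"

definition vertex_point :: "nat \<Rightarrow> nat \<Rightarrow> complex" where
  "vertex_point n p = circ (real p / real n)"

definition edge_segment :: "nat \<Rightarrow> nat \<Rightarrow> nat \<Rightarrow> complex set" where
  "edge_segment n p q = closed_segment (vertex_point n p) (vertex_point n q)"

definition adj :: "nat set set \<Rightarrow> nat rel" where
  "adj E = {(p, q). {p, q} \<in> E}"

definition is_cycle :: "nat set set \<Rightarrow> nat list \<Rightarrow> bool" where
  "is_cycle E c \<longleftrightarrow> 3 \<le> length c \<and> distinct c \<and>
     (\<forall>i<length c. (c ! i, c ! (Suc i mod length c)) \<in> adj E)"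

definition is_tree :: "nat \<Rightarrow> nat set set \<Rightarrow> bool" where
  "is_tree n E \<longleftrightarrow>
     E \<subseteq> {{p, q} | p q. p < n \<and> q < n \<and> p \<noteq> q} \<and>
     (\<forall>p<n. \<forall>q<n. (p, q) \<in> (adj E)\<^sup>*) \<and>
     (\<nexists>c. is_cycle E c)"

definition noncrossing_tree :: "nat \<Rightarrow> nat set set \<Rightarrow> bool" where
  "noncrossing_tree n E \<longleftrightarrow> is_tree n E \<and>
     (\<forall>p q r s. {p, q} \<in> E \<longrightarrow> {r, s} \<in> E \<longrightarrow> {p, q} \<noteq> {r, s} \<longrightarrow>
        edge_segment n p q \<inter> edge_segment n r s \<subseteq> vertex_point n ` ({p, q} \<inter> {r, s}))"

definition tree_figure :: "nat \<Rightarrow> nat set set \<Rightarrow> complex set" where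
  "tree_figure n E = \<Union>{edge_segment n p q | p q. {p, q} \<in> E}"

text \<open>The root is the vertex with label 0, that is, the point 1.\<close>

definition depth :: "nat set set \<Rightarrow> nat \<Rightarrow> nat" where
  "depth E p = (LEAST k. (0, p) \<in> adj E ^^ k)"

definition children :: "nat set set \<Rightarrow> nat \<Rightarrow> nat set" where
  "children E p = {q. {p, q} \<in> E \<and> depth E q = Suc (depth E p)}"

text \<open>\<open>descend E p u\<close> is the label of the vertex reached from \<open>p\<close> by following the word \<open>u\<close>, the
  children of each vertex being ordered by increasing label.\<close>

primrec descend :: "nat set set \<Rightarrow> nat \<Rightarrow> nat list \<Rightarrow> nat option" where
  "descend E p [] = Some p"
| "descend E p (i # u) =
     (if i < card (children E p) then descend E (sorted_list_of_set (children E p) ! i) u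
      else None)"

definition shape :: "nat set set \<Rightarrow> nat list set" where
  "shape E = {u. descend E 0 u \<noteq> None}"

lemma descend_snoc:
  "descend E p (u @ [i]) =
     (case descend E p u of None \<Rightarrow> None
      | Some q \<Rightarrow> if i < card (children E q)
                  then Some (sorted_list_of_set (children E q) ! i) else None)"
  by (induction u arbitrary: p) auto

lemma children_less: "is_tree n E \<Longrightarrow> children E p \<subseteq> {..<n}"
  by (fastforce simp: is_tree_def children_def doubleton_eq_iff)

lemma nth_children:
  assumes "is_tree n E" "i < card (children E p)"
  shows "sorted_list_of_set (children E p) ! i \<in> children E p"
proof -
  have "finite (children E p)" using children_less[OF assms(1)] finite_subset by blast
  then show ?thesis using assms(2) nth_mem[of i "sorted_list_of_set (children E p)"] by simp
qed

lemma descend_bounds: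
  assumes "is_tree n E" "descend E p u = Some q" "p < n"
  shows "q < n \<and> depth E q = depth E p + length u \<and> set u \<subseteq> {..<n}"
  using assms(2,3)
proof (induction u arbitrary: p)
  case (Cons i u)
  let ?q = "sorted_list_of_set (children E p) ! i"
  have i: "i < card (children E p)" and d: "descend E ?q u = Some q"
    using Cons.prems(1) by (auto split: if_splits)
  have q: "?q \<in> children E p" using nth_children[OF assms(1) i] .
  have "card (children E p) \<le> n"
    using card_mono[OF _ children_less[OF assms(1)], of p] by simp
  moreover have "?q < n" using q children_less[OF assms(1)] by blast
  ultimately show ?case
    using Cons.IH[OF d] q i by (auto simp: children_def)
qed auto

lemma plane_tree_shape:
  assumes "is_tree n E" "1 \<le> n"
  shows "plane_tree (shape E)"
proof -
  have "shape E \<subseteq> {u. set u \<subseteq> {..<n} \<and> length u \<le> Max (depth E ` {..<n})}"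
  proof
    fix u assume "u \<in> shape E"
    then obtain q where "descend E 0 u = Some q" by (auto simp: shape_def)
    then have q: "q < n" "depth E q = depth E 0 + length u" "set u \<subseteq> {..<n}"
      using descend_bounds[OF assms(1)] assms(2) by fastforce+
    have "depth E q \<le> Max (depth E ` {..<n})" using q(1) by (intro Max_ge) auto
    with q show "u \<in> {u. set u \<subseteq> {..<n} \<and> length u \<le> Max (depth E ` {..<n})}" by simp
  qed
  then have "finite (shape E)"
    by (rule finite_subset) (simp add: finite_lists_length_le)
  then show ?thesis
    by (auto simp: plane_tree_def shape_def descend_snoc split: option.splits if_splits)
qed


section \<open>The lamination coded by a function\<close>

definition coded_equiv :: "(real \<Rightarrow> real) \<Rightarrow> real \<Rightarrow> real \<Rightarrow> bool" where
  "coded_equiv f s t \<longleftrightarrow> f s = f t \<and> f t = (INF r\<in>{min s t..max s t}. f r)"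

definition lamination :: "(real \<Rightarrow> real) \<Rightarrow> complex set" where
  "lamination f =
     \<Union>{closed_segment (circ s) (circ t) | s t. s \<in> {0..1} \<and> t \<in> {0..1} \<and> coded_equiv f s t}"

definition inf_attained :: "(real \<Rightarrow> real) \<Rightarrow> real \<Rightarrow> real \<Rightarrow> bool" where
  "inf_attained f a b \<longleftrightarrow> (\<exists>x\<in>{a<..<b}. f x = (INF y\<in>{a<..<b}. f y))"

definition distinct_local_minima :: "(real \<Rightarrow> real) \<Rightarrow> bool" where
  "distinct_local_minima f \<longleftrightarrow>
     (\<forall>a b c d. 0 \<le> a \<longrightarrow> a < b \<longrightarrow> b < c \<longrightarrow> c < d \<longrightarrow> d \<le> 1 \<longrightarrow>
        inf_attained f a b \<longrightarrow> inf_attained f c d \<longrightarrow>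
        (INF y\<in>{a<..<b}. f y) \<noteq> (INF y\<in>{c<..<d}. f y))"

end

theory Submission
  imports Defs "HOL-Library.Sublist" "HOL-Library.Transitive_Closure_Table"
begin

text \<open>In a noncrossing tree the descendants of a vertex occupy an interval of labels, so the label of a
  vertex \<open>u\<close> agrees, up to the height of the tree, with the depth-first index of a descendant of \<open>u\<close>
  at which the Lukasiewicz path almost takes its minimum over the subtree of \<open>u\<close>. As degrees are
  negligible compared to \<open>B\<^sub>n\<close>, both ends of an edge are therefore close to a pair \<open>s \<sim>\<^sub>f t\<close>.

  Conversely, suppose that \<open>f\<close> takes smaller values just outside an interval than inside. Then some
  subtree spans the interval, and so does a slightly larger one. Their difference is
  connected and has vertices on both sides of the smaller subtree, which forces an edge from one side
  to the other. Since local minima are distinct, such intervals approximate every pair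
  \<open>s \<sim>\<^sub>f t\<close> other than the trivial ones.\<close>

section \<open>Words and the Lukasiewicz path\<close>

text \<open>The label of a vertex is not its depth-first index: a vertex sits somewhere inside the
  range of labels of its own descendants, so the two numbers can differ by a positive fraction of
  \<open>n\<close>. What survives is that both orders agree on vertices neither of which is an
  ancestor of the other, and by the height hypothesis ancestors are negligible in number. Degrees
  are negligible because they are jumps of the path, up to 1, and the limit \<open>f\<close> is
  continuous. Noncrossing is used only combinatorially: edges with interleaved ends
  \<open>p < r < q < s\<close> are excluded. A compactness argument turns inequalities for
  \<open>f\<close> with a small error into closeness to an exact pair, uniformly over edges. In the
  converse direction the required \<open>n\<close> depends on the pair, and a finite net of pairs
  restores uniformity. The trivial pairs are \<open>(s, s)\<close> and, up to order,
  \<open>(0, 1)\<close>; their chords are single points of the circle, so a nearby vertex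
  suffices.\<close>

lemma append_less_append_iff [simp]: "w @ a < w @ b \<longleftrightarrow> a < b" for w a b :: "nat list"
  by (induction w) auto

lemma append_le_append_iff [simp]: "w @ a \<le> w @ b \<longleftrightarrow> a \<le> b" for w a b :: "nat list"
  by (induction w) auto

lemma prefix_imp_le: "prefix u v \<Longrightarrow> u \<le> v" for u v :: "nat list"
  by (metis Nil_le_Cons append_Nil2 append_le_append_iff prefixE)

lemma butlast_less: "u \<noteq> [] \<Longrightarrow> butlast u < u" for u :: "nat list"
  by (metis append_butlast_last_id append_less_append_iff append_self_conv Nil_less_Cons)

lemma parallel_less_decomp:
  fixes u v :: "nat list"
  assumes "u \<parallel> v" "u < v"
  obtains w i i' a b where "u = w @ i # a" "v = w @ i' # b" "i < i'"
proof -
  obtain w i a i' b where "i \<noteq> i'" "u = w @ i # a" "v = w @ i' # b"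
    using parallel_decomp[OF assms(1)] by blast
  then show thesis using that assms(2) by auto
qed

lemma parallel_less_extend:
  fixes u v :: "nat list"
  assumes "u \<parallel> v" "u < v" "prefix u u'" "prefix v v'"
  shows "u' < v'"
proof -
  obtain w i i' a b where "u = w @ i # a" "v = w @ i' # b" "i < i'"
    using parallel_less_decomp[OF assms(1,2)] .
  then show ?thesis using assms(3,4) by (auto simp: prefix_def)
qed

text \<open>A word above \<open>u\<close> that does not extend \<open>u\<close> is parallel to it,
  hence above every extension of \<open>u\<close>. Thus each subtree is an interval of the
  depth-first order, with its root first.\<close>

lemma prefix_between:
  fixes u v x :: "nat list"
  assumes "u \<le> x" "x \<le> v" "prefix u v"
  shows "prefix u x"
proof (rule ccontr)
  assume n: "\<not> prefix u x"
  then have "\<not> prefix x u" using prefix_imp_le[of x u] assms(1) by auto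
  with n have p: "u \<parallel> x" by (simp add: parallel_def)
  moreover have "u < x" using assms(1) n by (auto simp: order_less_le)
  ultimately have "v < x" using parallel_less_extend[of u x v x] assms(3) by simp
  with assms(2) show False by simp
qed

lemma parallel_if_le: "u \<le> x \<Longrightarrow> \<not> prefix u x \<Longrightarrow> u \<parallel> x" for u x :: "nat list"
  by (metis dual_order.antisym parallelI prefix_imp_le prefix_order.dual_order.refl)

lemma strict_prefix_child:
  assumes "strict_prefix u v"
  obtains i where "prefix (u @ [i]) v"
proof -
  from assms obtain i y where "v = u @ i # y" by (rule strict_prefixE')
  then have "prefix (u @ [i]) v" by simp
  then show thesis by (rule that)
qed

lemma prefix_butlast: "prefix u x \<Longrightarrow> u \<noteq> x \<Longrightarrow> prefix u (butlast x)"
  by (metis append_butlast_last_id butlast.simps(1) prefix_snoc prefix_bot.extremum_unique)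

section \<open>Depth-first exploration of a finite plane tree\<close>

locale finite_plane_tree =
  fixes \<tau> :: "nat list set"
  assumes plane_tree: "plane_tree \<tau>"
begin

lemma finite_tree [simp]: "finite \<tau>"
  and Nil_in_tree [simp]: "[] \<in> \<tau>"
  and snoc_in_tree: "u @ [i] \<in> \<tau> \<Longrightarrow> u \<in> \<tau>"
  using plane_tree unfolding plane_tree_def by blast+

lemma append_in_tree: "u @ v \<in> \<tau> \<Longrightarrow> u \<in> \<tau>"
proof (induction v rule: rev_induct)
  case (snoc i v)
  then show ?case using snoc_in_tree[of "u @ v" i] by simp
qed simp

lemma prefix_in_tree: "v \<in> \<tau> \<Longrightarrow> prefix u v \<Longrightarrow> u \<in> \<tau>"
  using append_in_tree by (auto simp: prefix_def)

lemma num_children_eq: "num_children \<tau> u = card {x \<in> \<tau>. x \<noteq> [] \<and> butlast x = u}"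
proof -
  have "x \<in> (\<lambda>i. u @ [i]) ` {i. u @ [i] \<in> \<tau>}" if "x \<in> \<tau>" "x \<noteq> []" "butlast x = u" for x
    using that append_butlast_last_id[of x] by (intro image_eqI[of _ _ "last x"]) auto
  then have "{x \<in> \<tau>. x \<noteq> [] \<and> butlast x = u} = (\<lambda>i. u @ [i]) ` {i. u @ [i] \<in> \<tau>}"
    by auto
  then show ?thesis
    by (simp add: num_children_def card_image inj_on_def)
qed

text \<open>Counting predecessors turns comparisons between indices and labels into inclusions
  between finite sets.\<close>

definition dfs_index :: "nat list \<Rightarrow> nat" where
  "dfs_index v = card {w \<in> \<tau>. w < v}"

lemma dfs_index_mono: "u \<le> v \<Longrightarrow> dfs_index u \<le> dfs_index v"
  by (auto simp: dfs_index_def intro!: card_mono)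

lemma dfs_index_less: "v \<in> \<tau> \<Longrightarrow> dfs_index v < card \<tau>"
  unfolding dfs_index_def by (rule psubset_card_mono) auto

lemma dfs_vertex_strict_mono:
  assumes "i < j" "j < card \<tau>"
  shows "dfs_vertex \<tau> i < dfs_vertex \<tau> j"
  unfolding dfs_vertex_def
  using assms sorted_wrt_nth_less[OF strict_sorted_list_of_set[of \<tau>], of i j] by simp

lemma dfs_vertex_in: "j < card \<tau> \<Longrightarrow> dfs_vertex \<tau> j \<in> \<tau>"
  unfolding dfs_vertex_def using nth_mem[of j "sorted_list_of_set \<tau>"] by simp

lemma dfs_vertex_surj:
  assumes "v \<in> \<tau>"
  obtains j where "j < card \<tau>" "dfs_vertex \<tau> j = v"
  using assms in_set_conv_nth[of v "sorted_list_of_set \<tau>"] unfolding dfs_vertex_def by auto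

lemma less_dfs_vertex:
  assumes "j < card \<tau>"
  shows "{w \<in> \<tau>. w < dfs_vertex \<tau> j} = dfs_vertex \<tau> ` {..<j}"
proof (intro set_eqI iffI)
  fix w assume w: "w \<in> {w \<in> \<tau>. w < dfs_vertex \<tau> j}"
  then obtain i where i: "i < card \<tau>" "dfs_vertex \<tau> i = w" using dfs_vertex_surj by blast
  have "i < j"
    using w i dfs_vertex_strict_mono[of j i] by (cases i j rule: linorder_cases) auto
  then show "w \<in> dfs_vertex \<tau> ` {..<j}" using i by blast
next
  fix w assume "w \<in> dfs_vertex \<tau> ` {..<j}"
  then show "w \<in> {w \<in> \<tau>. w < dfs_vertex \<tau> j}"
    using assms dfs_vertex_strict_mono dfs_vertex_in by auto
qed

lemma inj_on_dfs_vertex: "j \<le> card \<tau> \<Longrightarrow> inj_on (dfs_vertex \<tau>) {..<j}"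
  by (rule linorder_inj_onI)
     (use dfs_vertex_strict_mono in \<open>auto, metis order_less_irrefl order_less_le_trans\<close>)

lemma dfs_index_dfs_vertex: "j < card \<tau> \<Longrightarrow> dfs_index (dfs_vertex \<tau> j) = j"
  unfolding dfs_index_def by (simp add: less_dfs_vertex card_image inj_on_dfs_vertex)

lemma dfs_vertex_dfs_index: "v \<in> \<tau> \<Longrightarrow> dfs_vertex \<tau> (dfs_index v) = v"
  using dfs_vertex_surj dfs_index_dfs_vertex by metis

text \<open>The stack of the exploration at \<open>v\<close>, without \<open>v\<close> itself: it
  consists of the later siblings of \<open>v\<close> and of its ancestors.\<close>

definition pending :: "nat list \<Rightarrow> nat list set" where
  "pending v = {x \<in> \<tau>. v < x \<and> butlast x < v}"

lemma finite_pending [simp]: "finite (pending v)"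
  by (simp add: pending_def)

lemma lukasiewicz_eq_sum:
  "lukasiewicz \<tau> j = (\<Sum>i<j. int (num_children \<tau> (dfs_vertex \<tau> i))) - int j"
  by (induction j) auto

lemma sum_num_children:
  assumes "S \<subseteq> \<tau>"
  shows "(\<Sum>u\<in>S. num_children \<tau> u) = card {x \<in> \<tau>. x \<noteq> [] \<and> butlast x \<in> S}"
proof -
  have "finite S" using assms finite_subset finite_tree by blast
  then have "card (\<Union>u\<in>S. {x \<in> \<tau>. x \<noteq> [] \<and> butlast x = u}) = (\<Sum>u\<in>S. num_children \<tau> u)"
    by (subst card_UN_disjoint) (auto simp: num_children_eq)
  moreover have "(\<Union>u\<in>S. {x \<in> \<tau>. x \<noteq> [] \<and> butlast x = u}) = {x \<in> \<tau>. x \<noteq> [] \<and> butlast x \<in> S}"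
    by auto
  ultimately show ?thesis by simp
qed

lemma butlast_in_tree: "x \<in> \<tau> \<Longrightarrow> butlast x \<in> \<tau>"
  using prefix_in_tree prefixeq_butlast by blast

text \<open>The walk counts the vertices that are discovered but not yet visited: every visited vertex
  other than the root is the child of a previously visited one.\<close>

lemma lukasiewicz_dfs_index:
  assumes "v \<in> \<tau>"
  shows "lukasiewicz \<tau> (dfs_index v) = int (card (pending v))"
proof -
  let ?j = "dfs_index v"
  let ?P = "{w \<in> \<tau>. w < v}"
  have j: "?j < card \<tau>" using assms dfs_index_less by blast
  have "(\<Sum>i<?j. num_children \<tau> (dfs_vertex \<tau> i)) = (\<Sum>u\<in>dfs_vertex \<tau> ` {..<?j}. num_children \<tau> u)"
    using j by (simp add: sum.reindex inj_on_dfs_vertex)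
  also have "dfs_vertex \<tau> ` {..<?j} = ?P"
    using less_dfs_vertex[OF j] dfs_vertex_dfs_index[OF assms] by simp
  also have "(\<Sum>u\<in>?P. num_children \<tau> u) = card {x \<in> \<tau>. x \<noteq> [] \<and> butlast x \<in> ?P}"
    by (rule sum_num_children) auto
  \<comment> \<open>Including \<open>v\<close> and excluding the root cancel: the first set of the
    union has exactly \<open>?j\<close> elements.\<close>
  also have "{x \<in> \<tau>. x \<noteq> [] \<and> butlast x \<in> ?P} = ({w \<in> \<tau>. w \<le> v} - {[]}) \<union> pending v"
    using butlast_less butlast_in_tree
    by (auto simp: pending_def intro: order_less_le_trans)
  also have "card \<dots> = card ({w \<in> \<tau>. w \<le> v} - {[]}) + card (pending v)"
    by (rule card_Un_disjoint) (auto simp: pending_def)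
  also have "card ({w \<in> \<tau>. w \<le> v} - {[]}) = card {w \<in> \<tau>. w \<le> v} - 1"
    by (simp)
  also have "{w \<in> \<tau>. w \<le> v} = insert v ?P" using assms by auto
  finally have "(\<Sum>i<?j. num_children \<tau> (dfs_vertex \<tau> i)) = ?j + card (pending v)"
    by (simp add: dfs_index_def)
  then show ?thesis
    unfolding lukasiewicz_eq_sum by (simp flip: of_nat_sum)
qed

text \<open>A later sibling of \<open>u\<close> or of an ancestor of \<open>u\<close> waits until
  the subtree of \<open>u\<close> is exhausted. Hence over a subtree the path never goes below its
  value at the root of the subtree.\<close>

lemma pending_mono_prefix:
  assumes "prefix u v"
  shows "pending u \<subseteq> pending v"
proof
  fix x assume x: "x \<in> pending u"
  then have "\<not> prefix u (butlast x)" using prefix_imp_le by (fastforce simp: pending_def)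
  then have "\<not> prefix u x" using x prefix_butlast by (auto simp: pending_def)
  then have "v < x" using prefix_between[of u x v] assms x by (force simp: pending_def)
  moreover have "butlast x < v"
    using x prefix_imp_le[OF assms] by (auto simp: pending_def)
  ultimately show "x \<in> pending v" using x by (simp add: pending_def)
qed

text \<open>The new entries are later siblings of the child; a word below an earlier sibling
  precedes the child and is no longer waiting.\<close>

lemma pending_child:
  "pending (u @ [i]) \<subseteq> pending u \<union> {x \<in> \<tau>. x \<noteq> [] \<and> butlast x = u}"
proof
  fix x assume x: "x \<in> pending (u @ [i])"
  moreover have "u < u @ [i]" using append_less_append_iff[of u "[]" "[i]"] by simp
  ultimately have ux: "u < x" unfolding pending_def by (auto intro: order_less_trans)
  have bx: "butlast x < u @ [i]" using x by (simp add: pending_def)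
  show "x \<in> pending u \<union> {x \<in> \<tau>. x \<noteq> [] \<and> butlast x = u}"
  proof (cases "butlast x < u")
    case True
    with ux x show ?thesis by (simp add: pending_def)
  next
    case False
    then have "prefix u (butlast x)" using prefix_between[of u "butlast x" "u @ [i]"] bx by simp
    then obtain y where y: "butlast x = u @ y" by (auto simp: prefix_def)
    have xne: "x \<noteq> []" using ux by auto
    show ?thesis
    proof (cases y)
      case Nil
      with y x xne show ?thesis by (simp add: pending_def)
    next
      case (Cons j z)
      then have "j < i" using bx y by simp
      moreover have "x = (u @ j # z) @ [last x]" using y Cons xne by (metis append_butlast_last_id)
      ultimately have "x < u @ [i]" by (metis Cons_less_Cons append_Cons append_assoc append_less_append_iff)
      with x show ?thesis by (auto simp: pending_def dest: order.asym)
    qed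
  qed
qed

lemma card_pending_child: "card (pending (u @ [i])) \<le> card (pending u) + num_children \<tau> u"
proof -
  have "card (pending (u @ [i])) \<le> card (pending u \<union> {x \<in> \<tau>. x \<noteq> [] \<and> butlast x = u})"
    by (rule card_mono[OF _ pending_child]) auto
  also have "\<dots> \<le> card (pending u) + num_children \<tau> u"
    unfolding num_children_eq by (rule card_Un_le)
  finally show ?thesis .
qed

text \<open>At the last descendant \<open>w\<close> of \<open>u\<close> no descendant of
  \<open>u\<close> is waiting any more, so the path has come back to a value no larger than at
  \<open>u\<close>.\<close>

lemma pending_last:
  assumes "prefix u w" "\<And>v. v \<in> \<tau> \<Longrightarrow> prefix u v \<Longrightarrow> v \<le> w"
  shows "pending w \<subseteq> pending u"
proof
  fix x assume x: "x \<in> pending w"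
  then have "\<not> prefix u x" using assms(2)[of x] by (auto simp: pending_def)
  then have "\<not> prefix u (butlast x)" using prefixeq_butlast prefix_order.trans by blast
  then have "butlast x < u"
    using prefix_between[of u "butlast x" w] x assms(1) by (force simp: pending_def)
  then show "x \<in> pending u" using x prefix_imp_le[OF assms(1)] by (auto simp: pending_def)
qed

text \<open>The ancestors of \<open>u\<close>, itself included, form a chain with one word per
  length. Every error term \<open>height \<tau>\<close> below comes from this count.\<close>

lemma card_prefixes_le:
  assumes "u \<in> \<tau>"
  shows "card {x. prefix x u} \<le> height \<tau> + 1"
  using assms by (simp add: height_def flip: set_prefixes_eq)

lemma finite_prefixes [simp]: "finite {x. prefix x (u :: nat list)}"
  by (simp flip: set_prefixes_eq)

lemma lukasiewicz_eq_pending: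
  "j < card \<tau> \<Longrightarrow> lukasiewicz \<tau> j = int (card (pending (dfs_vertex \<tau> j)))"
  using lukasiewicz_dfs_index[OF dfs_vertex_in] dfs_index_dfs_vertex by simp

lemma dfs_vertex_mono: "i \<le> j \<Longrightarrow> j < card \<tau> \<Longrightarrow> dfs_vertex \<tau> i \<le> dfs_vertex \<tau> j"
  using dfs_vertex_strict_mono[of i j] by (cases "i = j") auto

text \<open>The deepest common ancestor \<open>z\<close> of the vertices at \<open>a\<close> and
  \<open>b\<close> works. Some vertex between them has a path value exceeding that at
  \<open>z\<close> by at most \<open>K\<close>, so by \<open>W\<close> the values at
  \<open>a'\<close> and \<open>b'\<close> are strictly below the value at \<open>z\<close>, which
  \<open>pending_mono_prefix\<close> forbids inside the subtree of \<open>z\<close>.\<close>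

lemma subtree_between:
  assumes "a' < a" "a \<le> b" "b < b'" "b' < card \<tau>"
    and K: "\<And>u. u \<in> \<tau> \<Longrightarrow> num_children \<tau> u \<le> K"
    and W: "\<And>i. i \<in> {a..b} \<Longrightarrow> lukasiewicz \<tau> a' + int K < lukasiewicz \<tau> i \<and>
      lukasiewicz \<tau> b' + int K < lukasiewicz \<tau> i"
  obtains z where "z \<in> \<tau>" "prefix z (dfs_vertex \<tau> a)" "prefix z (dfs_vertex \<tau> b)"
    "\<not> prefix z (dfs_vertex \<tau> a')" "\<not> prefix z (dfs_vertex \<tau> b')"
proof -
  let ?u = "dfs_vertex \<tau>"
  have ut: "?u a \<in> \<tau>" "?u b \<in> \<tau>" using assms(1-4) dfs_vertex_in by auto
  have le: "?u a \<le> ?u b" using assms(1-4) dfs_vertex_mono by simp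
  have "\<exists>z v. prefix z (?u a) \<and> prefix z (?u b) \<and> v \<in> \<tau> \<and> ?u a \<le> v \<and> v \<le> ?u b \<and>
    card (pending v) \<le> card (pending z) + K"
  proof (cases "prefix (?u a) (?u b)")
    case True
    then show ?thesis using ut le by (intro exI[of _ "?u a"]) auto
  next
    case False
    then have "?u a \<parallel> ?u b" "?u a < ?u b" using le parallel_if_le by (auto simp: order_less_le)
    then obtain w i i' x y where w: "?u a = w @ i # x" "?u b = w @ i' # y" "i < i'"
      by (rule parallel_less_decomp)
    \<comment> \<open>The vertex sought is the child of \<open>w\<close> towards the vertex at
      \<open>b\<close>: it comes after the one at \<open>a\<close>, and
      \<open>card_pending_child\<close> applies to it.\<close>
    have "prefix (w @ [i']) (?u b)" using w(2) by simp
    then have v: "w @ [i'] \<in> \<tau>" "w @ [i'] \<le> ?u b" using prefix_in_tree ut prefix_imp_le by blast+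
    have "num_children \<tau> w \<le> K" using K snoc_in_tree[OF v(1)] by simp
    then have "card (pending (w @ [i'])) \<le> card (pending w) + K"
      using card_pending_child[of w i'] by simp
    moreover have "?u a \<le> w @ [i']" using w by simp
    ultimately show ?thesis using v w by (intro exI[of _ w] exI[of _ "w @ [i']"]) auto
  qed
  then obtain z v where z: "prefix z (?u a)" "prefix z (?u b)" "v \<in> \<tau>" "?u a \<le> v" "v \<le> ?u b"
    "card (pending v) \<le> card (pending z) + K" by blast
  have "dfs_index v \<in> {a..b}"
    using dfs_index_mono[OF z(4)] dfs_index_mono[OF z(5)] assms(1-4) by (simp add: dfs_index_dfs_vertex)
  from W[OF this] have less: "lukasiewicz \<tau> a' < int (card (pending z))"
    "lukasiewicz \<tau> b' < int (card (pending z))"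
    using z(6) lukasiewicz_dfs_index[OF z(3)] by auto
  have "\<not> prefix z (?u j)" if "j < card \<tau>" "lukasiewicz \<tau> j < int (card (pending z))" for j
    using that card_mono[OF finite_pending pending_mono_prefix, of z "?u j"]
    by (auto simp: lukasiewicz_eq_pending)
  then show thesis using that[of z] z less prefix_in_tree[OF ut(1) z(1)] assms(1-4) by auto
qed

end

section \<open>Labellings\<close>

lemma card_diff_le:
  assumes "finite Y" "finite Z" "X \<subseteq> Y \<union> Z"
  shows "card X \<le> card Y + card Z"
  using card_mono[of "Y \<union> Z" X] card_Un_le[of Y Z] assms by simp

text \<open>What the noncrossing condition provides: labels respect the depth-first order except
  between ancestor and descendant, and a vertex is never placed inside the label range of the
  subtree of one of its children.\<close>

locale labelled_tree = finite_plane_tree +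
  fixes lab :: "nat list \<Rightarrow> nat"
  assumes bij_lab: "bij_betw lab \<tau> {..<card \<tau>}"
    and lab_parallel: "u \<in> \<tau> \<Longrightarrow> v \<in> \<tau> \<Longrightarrow> u \<parallel> v \<Longrightarrow> u < v \<Longrightarrow> lab u < lab v"
    and lab_child: "v \<in> \<tau> \<Longrightarrow> v' \<in> \<tau> \<Longrightarrow> prefix (u @ [i]) v \<Longrightarrow> prefix (u @ [i]) v' \<Longrightarrow>
      lab u < lab v \<Longrightarrow> lab u < lab v'"
begin

lemma inj_lab: "inj_on lab \<tau>"
  using bij_lab by (auto simp: bij_betw_def)

lemma card_lab_less:
  assumes "m \<le> card \<tau>"
  shows "card {x \<in> \<tau>. lab x < m} = m"
proof -
  have "lab ` {x \<in> \<tau>. lab x < m} = lab ` \<tau> \<inter> {..<m}"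
    by auto
  also have "\<dots> = {..<m}" using bij_lab assms by (auto simp: bij_betw_def)
  finally have "lab ` {x \<in> \<tau>. lab x < m} = {..<m}" .
  then have "card (lab ` {x \<in> \<tau>. lab x < m}) = m" by simp
  then show ?thesis using card_image[OF inj_on_subset[OF inj_lab], of "{x \<in> \<tau>. lab x < m}"] by auto
qed

lemma lab_less: "u \<in> \<tau> \<Longrightarrow> lab u < card \<tau>"
  using bij_lab by (auto simp: bij_betw_def)

lemma card_lab_less_lab: "u \<in> \<tau> \<Longrightarrow> card {x \<in> \<tau>. lab x < lab u} = lab u"
  using card_lab_less[of "lab u"] lab_less[of u] by simp

text \<open>The label of a vertex is close to the depth-first index of its first child with larger label
  or, if there is none, of its last descendant.\<close>

lemma lab_near_dfs_index:
  assumes u: "u \<in> \<tau>"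
  obtains w where "w \<in> \<tau>" "prefix u w" "card (pending w) \<le> card (pending u) + num_children \<tau> u"
    "lab u \<le> dfs_index w + height \<tau> + 2" "dfs_index w \<le> lab u + height \<tau> + 2"
proof -
  note result = that
  \<comment> \<open>Initial segments of the two orders are compared. The one for labels exceeds the
    other by at most \<open>w\<close>, and is exceeded by at most the ancestors of \<open>u\<close>;
    \<open>height \<tau> + 2\<close> covers both errors.\<close>
  have main: thesis
    if w: "w \<in> \<tau>" "prefix u w" "card (pending w) \<le> card (pending u) + num_children \<tau> u"
      and 1: "\<And>x. x \<in> \<tau> \<Longrightarrow> lab x < lab u \<Longrightarrow> x < w \<or> x = w"
      and 2: "\<And>x. x \<in> \<tau> \<Longrightarrow> x < w \<Longrightarrow> lab x < lab u \<or> prefix x u" for w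
  proof (rule result[OF w])
    have "card {x \<in> \<tau>. lab x < lab u} \<le> card {x \<in> \<tau>. x < w} + card {w}"
      by (rule card_diff_le) (use 1 in auto)
    then show "lab u \<le> dfs_index w + height \<tau> + 2"
      using card_lab_less_lab[OF u] by (simp add: dfs_index_def)
    have "card {x \<in> \<tau>. x < w} \<le> card {x \<in> \<tau>. lab x < lab u} + card {x. prefix x u}"
      by (rule card_diff_le) (use 2 in auto)
    then show "dfs_index w \<le> lab u + height \<tau> + 2"
      using card_lab_less_lab[OF u] card_prefixes_le[OF u] by (simp add: dfs_index_def)
  qed
  define R where "R = {v \<in> \<tau>. prefix u v \<and> lab u < lab v}"
  have finR: "finite R" by (simp add: R_def)
  have out: "lab x > lab u" if "x \<in> \<tau>" "\<not> prefix u x" "u \<le> x" for x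
    using lab_parallel[OF u that(1)] parallel_if_le that by (metis order_le_less prefix_order.refl)
  have before: "lab x < lab u \<or> prefix x u" if "x \<in> \<tau>" "x \<le> u" for x
    using lab_parallel[OF that(1) u] parallel_if_le[OF that(2)] that
    by (metis order_le_less prefix_order.refl)
  show thesis
  proof (cases "R = {}")
    case False
    define w where "w = Min R"
    have wR: "w \<in> R" and wmin: "\<And>v. v \<in> R \<Longrightarrow> w \<le> v"
      using False finR by (auto simp: w_def)
    then have "strict_prefix u w" by (auto simp: R_def strict_prefix_def)
    then obtain i where i: "prefix (u @ [i]) w" by (rule strict_prefix_child)
    have wt: "w \<in> \<tau>" and lw: "lab u < lab w" and pw: "prefix u w" using wR by (auto simp: R_def)
    have it: "u @ [i] \<in> \<tau>" using prefix_in_tree wt i by blast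
    \<comment> \<open>By \<open>lab_child\<close>, \<open>R\<close> contains the whole subtree of a
      child as soon as it contains one of its vertices, so the minimum of \<open>R\<close> is a
      child of \<open>u\<close>.\<close>
    have "u @ [i] \<in> R" using lab_child[OF wt it i _ lw] it by (simp add: R_def)
    then have w: "w = u @ [i]" using wmin prefix_imp_le[OF i] by force
    show thesis
    proof (rule main[OF wt pw])
      show "card (pending w) \<le> card (pending u) + num_children \<tau> u"
        unfolding w by (rule card_pending_child)
      fix x assume x: "x \<in> \<tau>"
      show "x < w \<or> x = w" if l: "lab x < lab u"
      proof (rule ccontr)
        assume "\<not> (x < w \<or> x = w)"
        then have wx: "w < x" by auto
        show False
        proof (cases "prefix w x")
          case True
          then have "lab u < lab x" using lab_child[of w x u i] wt x lw w by simp
          with l show False by simp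
        next
          case False
          then have "lab w < lab x" using lab_parallel[OF wt x] parallel_if_le wx by simp
          with lw l show False by simp
        qed
      qed
      show "lab x < lab u \<or> prefix x u" if xw: "x < w"
      proof (cases "x \<le> u")
        case True
        then show ?thesis using before x by blast
      next
        case False
        then have "prefix u x" using prefix_between[of u x w] xw pw by simp
        moreover have "x \<notin> R" using wmin xw by fastforce
        ultimately have "lab x \<le> lab u" using x by (simp add: R_def)
        moreover have "lab x \<noteq> lab u" using inj_onD[OF inj_lab _ x u] False by auto
        ultimately show ?thesis by simp
      qed
    qed
  next
    case True
    \<comment> \<open>Here all other descendants of \<open>u\<close> are labelled before it, and
      \<open>pending_last\<close> bounds the stack at the last of them.\<close>
    define w where "w = Max {v \<in> \<tau>. prefix u v}"
    have ne: "{v \<in> \<tau>. prefix u v} \<noteq> {}" using u by blast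
    have wt: "w \<in> \<tau>" and pw: "prefix u w" using Max_in[OF _ ne] by (auto simp: w_def)
    have wmax: "v \<le> w" if "v \<in> \<tau>" "prefix u v" for v using that by (auto simp: w_def)
    show thesis
    proof (rule main[OF wt pw])
      have "card (pending w) \<le> card (pending u)"
        by (rule card_mono[OF _ pending_last[OF pw wmax]]) auto
      then show "card (pending w) \<le> card (pending u) + num_children \<tau> u" by simp
      fix x assume x: "x \<in> \<tau>"
      show "x < w \<or> x = w" if l: "lab x < lab u"
      proof (rule ccontr)
        assume "\<not> (x < w \<or> x = w)"
        then have wx: "w < x" by auto
        then have "\<not> prefix u x" using wmax x by fastforce
        moreover have "u \<le> x" using wx prefix_imp_le[OF pw] by simp
        ultimately show False using out[OF x] l by simp
      qed
      show "lab x < lab u \<or> prefix x u" if xw: "x < w"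
      proof (cases "x \<le> u")
        case True
        then show ?thesis using before x by blast
      next
        case False
        then have "prefix u x" using prefix_between[of u x w] xw pw by simp
        then have "lab x \<le> lab u" using x True by (auto simp: R_def)
        moreover have "lab x \<noteq> lab u" using inj_onD[OF inj_lab _ x u] False by auto
        ultimately show ?thesis by simp
      qed
    qed
  qed
qed

text \<open>The subtree at \<open>z\<close> is located between the indices \<open>a2\<close> and \<open>b2\<close>, and the larger subtree
  at \<open>z'\<close> between \<open>a0\<close> and \<open>b0\<close>. The gap between \<open>a1\<close> and \<open>a2\<close> provides a vertex
  to the left of the subtree at \<open>z\<close> which is not an ancestor of \<open>z\<close>.\<close>

lemma edge_across:
  assumes idx: "a0 < a1" "a1 + height \<tau> < a2" "a2 < a" "a \<le> b" "b < b2" "b2 \<le> b1" "b1 < b0"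
      "b0 < card \<tau>"
    and K: "\<And>u. u \<in> \<tau> \<Longrightarrow> num_children \<tau> u \<le> K"
    and W1: "\<And>i. i \<in> {a1..b1} \<Longrightarrow> lukasiewicz \<tau> a0 + int K < lukasiewicz \<tau> i \<and>
      lukasiewicz \<tau> b0 + int K < lukasiewicz \<tau> i"
    and W2: "\<And>i. i \<in> {a..b} \<Longrightarrow> lukasiewicz \<tau> a2 + int K < lukasiewicz \<tau> i \<and>
      lukasiewicz \<tau> b2 + int K < lukasiewicz \<tau> i"
  obtains v i p q where "v @ [i] \<in> \<tau>" "{p, q} = {lab v, lab (v @ [i])}"
    "a0 \<le> p + height \<tau> + 1" "p \<le> a" "b \<le> q + height \<tau> + 1" "q \<le> b0"
proof -
  let ?u = "dfs_vertex \<tau>"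
  obtain z' where z': "z' \<in> \<tau>" "prefix z' (?u a1)" "prefix z' (?u b1)"
    "\<not> prefix z' (?u a0)" "\<not> prefix z' (?u b0)"
    by (rule subtree_between[of a0 a1 b1 b0 K]) (use idx K W1 in auto)
  obtain z where z: "z \<in> \<tau>" "prefix z (?u a)" "prefix z (?u b)"
    "\<not> prefix z (?u a2)" "\<not> prefix z (?u b2)"
    by (rule subtree_between[of a2 a b b2 K]) (use idx K W2 in auto)
  have um: "?u i \<le> ?u j" if "i \<le> j" "j \<le> b0" for i j
    using that dfs_vertex_mono[of i j] idx by simp
  have ut: "?u i \<in> \<tau>" if "i \<le> b0" for i
    using that dfs_vertex_in[of i] idx by simp
  have z'le: "z' \<le> ?u a1" and zle: "z \<le> ?u a" using z' z prefix_imp_le by auto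
  have mid': "prefix z' (?u i)" if "a1 \<le> i" "i \<le> b1" for i
    using prefix_between[of z' "?u i" "?u b1"] z' z'le um[of a1 i] um[of i b1] that idx by auto
  have not_z: "\<not> prefix z (?u i)" if "i \<le> a2" for i
  proof
    assume "prefix z (?u i)"
    then have "z \<le> ?u a2" using prefix_imp_le um[of i a2] that idx by (fastforce intro: order_trans)
    then show False using prefix_between[of z "?u a2" "?u a"] um[of a2 a] z idx by auto
  qed
  \<comment> \<open>Both are ancestors of the vertex at \<open>a\<close>, hence comparable. As
    \<open>z'\<close> is also an ancestor of the vertex at \<open>a1\<close>, which is not below
    \<open>z\<close>, it is the upper one.\<close>
  have "\<not> prefix z z'" using not_z[of a1] z' idx prefix_order.trans by fastforce
  moreover have "prefix z' (?u a)" using mid' idx by simp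
  ultimately have z'z: "prefix z' z" using z(2) prefix_same_cases by blast
  define S where "S = {v \<in> \<tau>. prefix z' v \<and> \<not> prefix z v}"
  \<comment> \<open>The two sides of the label range of the subtree at \<open>z\<close>.\<close>
  define left where "left v \<longleftrightarrow> (\<forall>x\<in>\<tau>. prefix z x \<longrightarrow> lab v < lab x)" for v
  define right where "right v \<longleftrightarrow> (\<forall>x\<in>\<tau>. prefix z x \<longrightarrow> lab x < lab v)" for v
  have par: "v \<parallel> x" if "v \<parallel> y" "prefix y x" for v x y :: "nat list"
    using that by (metis parallelD1 parallelD2 parallelI prefix_order.trans prefix_same_cases)
  have par_left: "left v" if "v \<in> \<tau>" "v \<parallel> z" "v < z" for v
    unfolding left_def using lab_parallel[OF that(1)] par[OF that(2)]
      parallel_less_extend[OF that(2,3)] by blast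
  have par_right: "right v" if "v \<in> \<tau>" "v \<parallel> z" "z < v" for v
  proof -
    have "z \<parallel> v" using that(2) by (simp add: parallel_commute)
    then show ?thesis
      unfolding right_def using lab_parallel[OF _ that(1)] par[OF that(2)]
        parallel_less_extend[OF _ that(3)] parallel_commute by blast
  qed
  \<comment> \<open>By \<open>lab_child\<close> a strict ancestor of \<open>z\<close> cannot lie
    inside the range; the other vertices of \<open>S\<close> are parallel to
    \<open>z\<close>.\<close>
  have side: "left v \<or> right v" if "v \<in> S" for v
  proof (cases "prefix v z")
    case True
    have vt: "v \<in> \<tau>" and nv: "\<not> prefix z v" using that by (auto simp: S_def)
    have "strict_prefix v z" using True nv by auto
    then obtain i where i: "prefix (v @ [i]) z" by (rule strict_prefix_child)
    have ne: "lab v \<noteq> lab x" if "x \<in> \<tau>" "prefix z x" for x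
      using inj_onD[OF inj_lab _ vt that(1)] that(2) nv by auto
    show ?thesis
    proof (cases "lab v < lab z")
      case True
      then have "left v"
        unfolding left_def using lab_child[OF z(1) _ i _ True] i prefix_order.trans by blast
      then show ?thesis ..
    next
      case False
      have "right v"
        unfolding right_def
      proof (intro ballI impI)
        fix x assume x: "x \<in> \<tau>" "prefix z x"
        have "\<not> lab v < lab x"
          using lab_child[OF x(1) z(1) _ i] False prefix_order.trans[OF i x(2)] by blast
        then show "lab x < lab v" using ne[OF x] by simp
      qed
      then show ?thesis ..
    qed
  next
    case False
    then have "v \<parallel> z" "v \<noteq> z" "v \<in> \<tau>" using that by (auto simp: S_def)
    then show ?thesis using par_left par_right by (meson linorder_neqE)
  qed
  have excl: "\<not> (left v \<and> right v)" for v
    using z(1) by (fastforce simp: left_def right_def)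
  \<comment> \<open>All four bounds are counts: a label is the number of smaller labels, an index
    the number of predecessors. The error \<open>height \<tau> + 1\<close> allows for the ancestors
    of \<open>z\<close> or \<open>z'\<close>, whose labels may be larger than that of
    \<open>v\<close>.\<close>
  have left_bound: "lab v \<le> a" if "v \<in> S" "left v" for v
  proof -
    have "x < ?u a" if "x \<in> \<tau>" "lab x < lab v" for x
    proof (rule ccontr)
      assume "\<not> x < ?u a"
      then have "z \<le> x" using zle by simp
      moreover have nz: "\<not> prefix z x" using \<open>left v\<close> that by (auto simp: left_def)
      ultimately have "lab z < lab x"
        using lab_parallel[OF z(1) that(1)] parallel_if_le
        by (metis order_le_less prefix_order.refl)
      moreover have "lab v < lab z" using \<open>left v\<close> z(1) by (simp add: left_def)
      ultimately show False using that by simp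
    qed
    then have "card {x \<in> \<tau>. lab x < lab v} \<le> dfs_index (?u a)"
      unfolding dfs_index_def by (intro card_mono) auto
    then show ?thesis using card_lab_less_lab[of v] that idx by (simp add: dfs_index_dfs_vertex S_def)
  qed
  have right_bound: "b \<le> lab v + height \<tau> + 1" if "v \<in> S" "right v" for v
  proof -
    have "lab x < lab v \<or> prefix x z" if x: "x \<in> \<tau>" "x < ?u b" for x
    proof (cases "prefix z x \<or> prefix x z")
      case True
      then show ?thesis using \<open>right v\<close> x by (auto simp: right_def)
    next
      case False
      then have "x \<parallel> z" by (simp add: parallel_def)
      moreover have "x < z" using prefix_between[of z x "?u b"] z(3) x(2) False by force
      ultimately have "lab x < lab z" using lab_parallel[OF x(1) z(1)] by simp
      moreover have "lab z < lab v" using \<open>right v\<close> z(1) by (simp add: right_def)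
      ultimately show ?thesis by simp
    qed
    then have "card {x \<in> \<tau>. x < ?u b} \<le> card {x \<in> \<tau>. lab x < lab v} + card {x. prefix x z}"
      by (intro card_diff_le) auto
    then have "dfs_index (?u b) \<le> lab v + (height \<tau> + 1)"
      using card_lab_less_lab[of v] that card_prefixes_le[OF z(1)] by (simp add: dfs_index_def S_def)
    then show ?thesis using idx by (simp add: dfs_index_dfs_vertex)
  qed
  have lower_bound: "a0 \<le> lab v + height \<tau> + 1" if "v \<in> S" for v
  proof -
    have v: "v \<in> \<tau>" "prefix z' v" using that by (auto simp: S_def)
    have "lab x < lab v \<or> prefix x z'" if x: "x \<in> \<tau>" "x < ?u a0" for x
    proof -
      have "x < ?u a1" using x um[of a0 a1] idx by simp
      moreover have "\<not> prefix z' x"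
      proof
        assume "prefix z' x"
        then have "z' \<le> ?u a0" using prefix_imp_le[of z' x] x by simp
        then show False using prefix_between[of z' "?u a0" "?u a1"] z' um[of a0 a1] idx by auto
      qed
      ultimately have "x < z'" using prefix_between[of z' x "?u a1"] z' by force
      show ?thesis
      proof (cases "prefix x z'")
        case False
        then have p: "x \<parallel> z'" using \<open>\<not> prefix z' x\<close> by (simp add: parallel_def)
        then have "lab x < lab v"
          using lab_parallel[OF x(1) v(1) par[OF p v(2)]] parallel_less_extend[OF p \<open>x < z'\<close> _ v(2)]
          by simp
        then show ?thesis ..
      qed simp
    qed
    then have "card {x \<in> \<tau>. x < ?u a0} \<le> card {x \<in> \<tau>. lab x < lab v} + card {x. prefix x z'}"
      by (intro card_diff_le) auto
    then have "dfs_index (?u a0) \<le> lab v + (height \<tau> + 1)"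
      using card_lab_less_lab[of v] v card_prefixes_le[OF z'(1)] by (simp add: dfs_index_def)
    then show ?thesis using idx by (simp add: dfs_index_dfs_vertex)
  qed
  have upper_bound: "lab v \<le> b0" if "v \<in> S" for v
  proof -
    have v: "v \<in> \<tau>" "prefix z' v" using that by (auto simp: S_def)
    have "x < ?u b0" if x: "x \<in> \<tau>" "lab x < lab v" for x
    proof (rule ccontr)
      assume nx: "\<not> x < ?u b0"
      have "z' \<le> ?u b0" using z'le um[of a1 b0] idx by simp
      then have "\<not> prefix z' x" and le: "z' \<le> x"
        using prefix_between[of z' "?u b0" x] z'(5) nx by (auto simp: not_less)
      then have p: "z' \<parallel> x" and l: "z' < x"
        using parallel_if_le by (auto simp: order_less_le)
      then have "v < x" using parallel_less_extend[OF p l v(2)] by simp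
      moreover have "v \<parallel> x" using par[of x z' v] p v(2) by (simp add: parallel_commute)
      ultimately have "lab v < lab x" using lab_parallel[OF v(1) x(1)] by simp
      with x show False by simp
    qed
    then have "card {x \<in> \<tau>. lab x < lab v} \<le> dfs_index (?u b0)"
      unfolding dfs_index_def by (intro card_mono) auto
    then show ?thesis using card_lab_less_lab[of v] v idx by (simp add: dfs_index_dfs_vertex)
  qed
  \<comment> \<open>These \<open>a2 + 1 - a1\<close> vertices are too many to be all ancestors of
    \<open>z\<close>; any other one lies in \<open>S\<close>, on the left.\<close>
  have "\<not> ?u ` {a1..a2} \<subseteq> {x. prefix x z}"
  proof
    assume "?u ` {a1..a2} \<subseteq> {x. prefix x z}"
    then have "card (?u ` {a1..a2}) \<le> height \<tau> + 1"
      using card_mono[OF finite_prefixes] card_prefixes_le[OF z(1)] order_trans by blast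
    moreover have "card (?u ` {a1..a2}) = a2 + 1 - a1"
      using card_image[OF inj_on_subset[OF inj_on_dfs_vertex[of "card \<tau>"]], of "{a1..a2}"] idx
      by (auto simp: subset_iff)
    ultimately show False using idx by simp
  qed
  then obtain i where i: "a1 \<le> i" "i \<le> a2" "\<not> prefix (?u i) z"
    unfolding image_subset_iff by (meson atLeastAtMost_iff mem_Collect_eq)
  have iz: "\<not> prefix z (?u i)" using not_z i by simp
  have "?u i < z"
    using prefix_between[of z "?u i" "?u a"] z(2) iz um[of i a] i idx by force
  then have l: "left (?u i)" "?u i \<in> S"
    using par_left[of "?u i"] ut[of i] mid'[of i] i iz idx by (auto simp: S_def parallel_def)
  have "z \<le> ?u b2" using zle um[of a b2] idx by simp
  then have zb: "z \<parallel> ?u b2" "z < ?u b2" using z(5) parallel_if_le by (auto simp: order_less_le)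
  have r: "right (?u b2)" "?u b2 \<in> S"
    using par_right[of "?u b2"] zb ut[of b2] mid'[of b2] z(5) idx
    by (auto simp: S_def parallel_commute)
  \<comment> \<open>\<open>S\<close> is a tree rooted at \<open>z'\<close>. If none of its edges
    changed sides, \<open>left\<close> would be constant on \<open>S\<close>.\<close>
  have "\<exists>v i. v \<in> S \<and> v @ [i] \<in> S \<and> left v \<noteq> left (v @ [i])"
  proof (rule ccontr)
    assume c: "\<not> ?thesis"
    have "left (z' @ y) = left z'" if "z' @ y \<in> S" for y
      using that
    proof (induction y rule: rev_induct)
      case (snoc i y)
      have "z' @ y \<in> \<tau>" using snoc.prems snoc_in_tree[of "z' @ y" i] by (simp add: S_def)
      then have "z' @ y \<in> S" using snoc.prems prefix_snoc[of z "z' @ y" i] by (simp add: S_def)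
      then show ?case using snoc c by (metis append_assoc)
    qed simp
    then have "left v = left z'" if "v \<in> S" for v using that by (force simp: S_def prefix_def)
    then show False using l r excl by blast
  qed
  then obtain v j where v: "v \<in> S" "v @ [j] \<in> S" "left v \<noteq> left (v @ [j])" by blast
  show thesis
  proof (cases "left v")
    case True
    then have "right (v @ [j])" using side[of "v @ [j]"] v by blast
    then show thesis
      using that[of v j "lab v" "lab (v @ [j])"] True v left_bound right_bound lower_bound upper_bound
      by (auto simp: S_def)
  next
    case False
    then have "right v" "left (v @ [j])" using side[of v] v by blast+
    then show thesis
      using that[of v j "lab (v @ [j])" "lab v"] v left_bound right_bound lower_bound upper_bound
      by (auto simp: S_def)
  qed
qed

end

section \<open>Chords of the circle\<close>

lemma circ_eq_cis: "circ s = cis (- (2 * pi * s))"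
  by (simp add: circ_def cis_conv_exp mult_ac)

lemma norm_circ [simp]: "norm (circ s) = 1"
  by (simp add: circ_eq_cis)

text \<open>After the rotation by \<open>\<omega>\<close> the first chord is the vertical segment
  between \<open>Complex k \<sigma>\<close> and \<open>Complex k (- \<sigma>)\<close>, and the ends
  of the second have real parts on both sides of \<open>k\<close>. The point of the second chord
  with real part \<open>k\<close> lies in the unit disk, so its imaginary part is at most
  \<open>\<sigma>\<close> in modulus.\<close>

lemma circ_chords_cross:
  assumes "a < b" "b < c" "c < d" "d < a + 1"
  shows "closed_segment (circ a) (circ c) \<inter> closed_segment (circ b) (circ d) \<noteq> {}"
proof -
  define m h where "m = (a + c) / 2" and "h = (c - a) / 2"
  define \<omega> where "\<omega> = cis (2 * pi * m)"
  have h: "0 < h" "h < 1/2" using assms by (auto simp: h_def)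
  define k where "k = cos (2 * pi * h)"
  define \<sigma> where "\<sigma> = sin (2 * pi * h)"
  have \<sigma>: "\<sigma> > 0" unfolding \<sigma>_def using h by (intro sin_gt_zero) auto
  have rot: "circ x * \<omega> = cis (2 * pi * (m - x))" for x
    by (simp add: circ_eq_cis \<omega>_def cis_mult algebra_simps)
  have ac: "circ a * \<omega> = Complex k \<sigma>" "circ c * \<omega> = Complex k (- \<sigma>)"
  proof -
    have "m - a = h" "m - c = - h" by (auto simp: m_def h_def field_simps)
    then show "circ a * \<omega> = Complex k \<sigma>" "circ c * \<omega> = Complex k (- \<sigma>)"
      by (auto simp: rot k_def \<sigma>_def complex_eq_iff)
  qed
  define B D where "B = Re (circ b * \<omega>)" and "D = Re (circ d * \<omega>)"
  have "B = cos (2 * pi * \<bar>m - b\<bar>)"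
    unfolding B_def rot using cos_abs_real[of "2 * pi * (m - b)"] by (simp add: abs_mult)
  also have "\<dots> > k"
  proof -
    have "\<bar>m - b\<bar> < h" using assms by (auto simp: m_def h_def abs_if field_simps)
    then have "2 * pi * \<bar>m - b\<bar> < 2 * pi * h" by (intro mult_strict_left_mono) auto
    moreover have "2 * pi * h \<le> 2 * pi * (1/2)" using h by (intro mult_left_mono) auto
    ultimately show ?thesis unfolding k_def by (intro cos_monotone_0_pi) auto
  qed
  finally have B: "B > k" .
  have "D = cos (2 * pi * (d - m))" unfolding D_def rot by (simp add: cos_diff algebra_simps)
  also have "\<dots> < k"
  \<comment> \<open>\<open>cos\<close> decreases only up to half a turn. Beyond it the angle is
    replaced by its complement to a full turn, which still exceeds that of \<open>h\<close> since
    \<open>d < a + 1\<close>.\<close>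
  proof (cases "d - m \<le> 1/2")
    case True
    then have "2 * pi * (d - m) \<le> 2 * pi * (1/2)" by (intro mult_left_mono) auto
    moreover have "2 * pi * h < 2 * pi * (d - m)"
      using assms by (intro mult_strict_left_mono) (auto simp: m_def h_def field_simps)
    ultimately show ?thesis
      unfolding k_def using h by (intro cos_monotone_0_pi) auto
  next
    case False
    then have "2 * pi * (1 - (d - m)) \<le> 2 * pi * (1/2)" by (intro mult_left_mono) auto
    moreover have "2 * pi * h < 2 * pi * (1 - (d - m))"
      using assms by (intro mult_strict_left_mono) (auto simp: m_def h_def field_simps)
    ultimately have "cos (2 * pi * (1 - (d - m))) < k"
      unfolding k_def using h by (intro cos_monotone_0_pi) auto
    moreover have "2 * pi * (1 - (d - m)) = 2 * pi - 2 * pi * (d - m)" by (simp add: algebra_simps)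
    ultimately show ?thesis by (simp add: cos_diff)
  qed
  finally have D: "D < k" .
  define t where "t = (B - k) / (B - D)"
  have t: "0 \<le> t" "t \<le> 1" using B D by (auto simp: t_def)
  define z where "z = (1 - t) *\<^sub>R circ b + t *\<^sub>R circ d"
  have z: "z \<in> closed_segment (circ b) (circ d)" using t by (auto simp: closed_segment_def z_def)
  have "Re (z * \<omega>) = (1 - t) * B + t * D"
    by (simp add: z_def B_def D_def algebra_simps)
  also have "\<dots> = B - t * (B - D)" by (simp add: algebra_simps)
  also have "\<dots> = k" using B D by (simp add: t_def)
  finally have Re: "Re (z * \<omega>) = k" .
  have "norm z \<le> 1"
    using closed_segment_subset[of "circ b" "cball 0 1" "circ d"] z by auto
  then have "norm (z * \<omega>) \<le> 1" by (simp add: \<omega>_def norm_mult)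
  then have "(Re (z * \<omega>))\<^sup>2 + (Im (z * \<omega>))\<^sup>2 \<le> 1"
    by (metis abs_norm_cancel cmod_power2 power2_le_iff_abs_le one_power2 zero_le_one abs_square_le_1)
  moreover have "k\<^sup>2 + \<sigma>\<^sup>2 = 1" by (simp add: k_def \<sigma>_def)
  ultimately have "(Im (z * \<omega>))\<^sup>2 \<le> \<sigma>\<^sup>2" unfolding Re by linarith
  then have Im: "\<bar>Im (z * \<omega>)\<bar> \<le> \<sigma>" using \<sigma> abs_le_square_iff[of "Im (z * \<omega>)" \<sigma>] by simp
  define u where "u = (1 - Im (z * \<omega>) / \<sigma>) / 2"
  have u: "0 \<le> u" "u \<le> 1" using Im \<sigma> by (auto simp: u_def field_simps abs_le_iff)
  have "z * \<omega> = ((1 - u) *\<^sub>R circ a + u *\<^sub>R circ c) * \<omega>"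
    unfolding distrib_right scaleR_scaleR mult_scaleR_left ac
    using Re \<sigma> by (auto simp: complex_eq_iff u_def field_simps)
  then have "z = (1 - u) *\<^sub>R circ a + u *\<^sub>R circ c" by (simp add: \<omega>_def)
  then have "z \<in> closed_segment (circ a) (circ c)" using u by (auto simp: closed_segment_def)
  with z show ?thesis by blast
qed

section \<open>Interleaved edges and paths\<close>

lemma noncrossing_edges:
  assumes "noncrossing_tree n E" "{p, q} \<in> E" "{r, s} \<in> E" "p < r" "r < q" "q < s"
  shows False
proof -
  have "s < n"
    using assms(1,3) by (force simp: noncrossing_tree_def is_tree_def doubleton_eq_iff)
  then have "edge_segment n p q \<inter> edge_segment n r s \<noteq> {}"
    unfolding edge_segment_def vertex_point_def using assms(4-6)
    by (intro circ_chords_cross) (auto simp: field_simps)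
  moreover have "{p, q} \<noteq> {r, s}" using assms(4-6) by (auto simp: doubleton_eq_iff)
  then have "edge_segment n p q \<inter> edge_segment n r s \<subseteq> vertex_point n ` ({p, q} \<inter> {r, s})"
    using assms(1-3) unfolding noncrossing_tree_def by blast
  ultimately show False using assms(4-6) by auto
qed

lemma edge_side:
  assumes "noncrossing_tree n E" "{r, s} \<in> E" "{c, d} \<in> E" "r < c" "c < s" "d \<noteq> r" "d \<noteq> s"
  shows "r < d \<and> d < s"
proof (rule ccontr)
  assume "\<not> ?thesis"
  then consider "d < r" | "s < d" using assms(6,7) by linarith
  then show False
  proof cases
    case 1
    then show False using noncrossing_edges[OF assms(1), of d c r s] assms by (simp add: insert_commute)
  next
    case 2
    then show False using noncrossing_edges[OF assms(1), of r s c d] assms by simp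
  qed
qed

lemma path_side:
  assumes nc: "noncrossing_tree n E" and e: "{r, s} \<in> E" "r \<notin> C" "s \<notin> C"
    and path: "(x, y) \<in> (adj E \<inter> C \<times> C)\<^sup>*" and x: "r < x" "x < s"
  shows "r < y \<and> y < s"
  using path
proof (induction rule: rtrancl_induct)
  case (step y w)
  then show ?case using edge_side[OF nc e(1), of y w] e by (auto simp: adj_def)
qed (use x in auto)

lemma sym_adj: "sym (adj E \<inter> C \<times> C)"
  by (auto simp: sym_def adj_def insert_commute)

text \<open>A discrete Jordan argument. The path through \<open>C'\<close> starts at
  \<open>r < x\<close>, so it needs an edge to enter the gap between \<open>x\<close> and
  \<open>y\<close>. This edge has one end in the gap and one outside, and separates \<open>x\<close>
  from \<open>y\<close>; by \<open>path_side\<close> the path through \<open>C\<close> could not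
  connect them.\<close>

lemma paths_not_interleaved:
  assumes nc: "noncrossing_tree n E" and "C \<inter> C' = {}"
    and xy: "(x, y) \<in> (adj E \<inter> C \<times> C)\<^sup>*" "x \<in> C"
    and rs: "(r, s) \<in> (adj E \<inter> C' \<times> C')\<^sup>*" and "r < x" "x < s" "s < y"
  shows False
proof -
  have yx: "(y, x) \<in> (adj E \<inter> C \<times> C)\<^sup>*"
    using xy(1) sym_rtrancl[OF sym_adj] by (blast dest: symD)
  have y: "y \<in> C" using xy by (induction) auto
  have "\<not> (x < s \<and> s < y)" using rs
  proof (induction rule: rtrancl_induct)
    case (step w v)
    then have e: "{w, v} \<in> E" "{v, w} \<in> E" and C: "w \<notin> C" "v \<notin> C"
      using assms(2) by (auto simp: adj_def insert_commute)
    then have "w \<noteq> x" "w \<noteq> y" using y xy(2) by auto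
    then consider "w < x" | "y < w" using step.IH by linarith
    then show ?case
    proof cases
      case 1
      then show ?thesis using path_side[OF nc e(1) C xy(1)] by auto
    next
      case 2
      then show ?thesis using path_side[OF nc e(2) C(2,1) yx] by auto
    qed
  qed (use assms in auto)
  with assms show False by simp
qed

section \<open>The shape of a noncrossing tree\<close>

lemma edge_less:
  assumes "is_tree n E" "{p, q} \<in> E"
  shows "p < n" "q < n" "p \<noteq> q"
  using assms by (auto simp: is_tree_def doubleton_eq_iff)

text \<open>Every edge of a tree is a bridge: a repetition-free detour closes up to a cycle.
  Acyclicity is used below only in this form.\<close>

lemma no_detour:
  assumes "is_tree n E" "{p, q} \<in> E"
  shows "(p, q) \<notin> (adj (E - {{p, q}}))\<^sup>*"
proof
  let ?r = "\<lambda>x y. (x, y) \<in> adj (E - {{p, q}})"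
  assume "(p, q) \<in> (adj (E - {{p, q}}))\<^sup>*"
  then have "?r\<^sup>*\<^sup>* p q" by (simp add: rtranclp_rtrancl_eq)
  then obtain ys where "rtrancl_path ?r p ys q" by (auto simp: rtranclp_eq_rtrancl_path)
  then obtain xs where xs: "rtrancl_path ?r p xs q" and d: "distinct (p # xs)"
    by (rule rtrancl_path_distinct)
  have pq: "p \<noteq> q" using edge_less[OF assms] by simp
  have ne: "xs \<noteq> []" using xs pq by (auto elim: rtrancl_path.cases)
  have last: "last xs = q" using rtrancl_path_last[OF xs ne] .
  have nth: "?r ((p # xs) ! i) (xs ! i)" if "i < length xs" for i
    using rtrancl_path_nth[OF xs that] .
  \<comment> \<open>A one-step detour would be the removed edge itself; this is what gives the cycle
    at least three vertices.\<close>
  have "length xs \<noteq> 1"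
  proof
    assume "length xs = 1"
    then have "?r p q" using nth[of 0] last ne by (cases xs) auto
    then show False by (simp add: adj_def)
  qed
  then have "length xs \<ge> 2" using ne by (cases xs; cases "tl xs") auto
  moreover have "((p # xs) ! i, (p # xs) ! (Suc i mod length (p # xs))) \<in> adj E"
    if "i < length (p # xs)" for i
  proof (cases "i < length xs")
    case True
    then show ?thesis using nth[OF True] by (auto simp: adj_def)
  next
    case False
    then have "i = length xs" using that by simp
    then show ?thesis
      using last ne assms(2) by (auto simp: adj_def last_conv_nth nth_Cons' insert_commute)
  qed
  ultimately have "is_cycle E (p # xs)" using d by (simp add: is_cycle_def)
  then show False using assms(1) by (auto simp: is_tree_def)
qed

section \<open>Depths and parents\<close>

locale rooted_tree =
  fixes n :: nat and E :: "nat set set"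
  assumes tree: "is_tree n E" and pos: "1 \<le> n"
begin

lemma depth_path:
  assumes "p < n"
  shows "(0, p) \<in> adj E ^^ depth E p"
proof -
  have "(0, p) \<in> (adj E)\<^sup>*" using tree pos assms by (auto simp: is_tree_def)
  then obtain k where "(0, p) \<in> adj E ^^ k" by (auto simp: rtrancl_power)
  then show ?thesis unfolding depth_def by (rule LeastI)
qed

lemma depth_le: "(0, p) \<in> adj E ^^ k \<Longrightarrow> depth E p \<le> k"
  unfolding depth_def by (rule Least_le)

lemma depth_root [simp]: "depth E 0 = 0"
  using depth_le[of 0 0] by simp

lemma depth_edge_le: "{p, q} \<in> E \<Longrightarrow> depth E q \<le> Suc (depth E p)"
  using depth_path[of p] edge_less[OF tree, of p q]
  by (intro depth_le) (auto simp: adj_def)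

lemma parent_exists:
  assumes "q < n" "q \<noteq> 0"
  obtains p where "q \<in> children E p" "p < n"
proof -
  obtain k where k: "depth E q = Suc k"
    using depth_path[OF assms(1)] assms(2) by (cases "depth E q") auto
  then have "(0, q) \<in> adj E ^^ Suc k" using depth_path[OF assms(1)] by simp
  then obtain p where p: "(0, p) \<in> adj E ^^ k" "{p, q} \<in> E" by (auto simp: adj_def)
  have "depth E q = Suc (depth E p)" using depth_le[OF p(1)] depth_edge_le[OF p(2)] k by simp
  then show thesis using that[of p] p(2) edge_less[OF tree p(2)] by (auto simp: children_def)
qed

text \<open>Climbing from parent to parent. The edge set \<open>F\<close> is left free so that the
  climb can be made in \<open>E\<close> without a given edge, against
  \<open>no_detour\<close>.\<close>

lemma path_to_root:
  assumes "q < n" "\<And>x y. {x, y} \<in> E \<Longrightarrow> depth E y = Suc (depth E x) \<Longrightarrow> depth E y \<le> depth E q \<Longrightarrow> {x, y} \<in> F"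
  shows "(q, 0) \<in> (adj F)\<^sup>*"
  using assms
proof (induction "depth E q" arbitrary: q rule: less_induct)
  case less
  show ?case
  proof (cases "q = 0")
    case False
    then obtain p where p: "q \<in> children E p" "p < n" using parent_exists less.prems by blast
    then have d: "depth E q = Suc (depth E p)" and e: "{p, q} \<in> E" by (auto simp: children_def)
    have "(p, 0) \<in> (adj F)\<^sup>*" using less.hyps[of p] less.prems d p by simp
    moreover have "(q, p) \<in> adj F" using less.prems(2)[OF e d] by (simp add: adj_def insert_commute)
    ultimately show ?thesis by (rule converse_rtrancl_into_rtrancl[rotated])
  qed simp
qed

lemma connected_via_root:
  assumes "(p, 0) \<in> (adj F)\<^sup>*" "(q, 0) \<in> (adj F)\<^sup>*"
  shows "(p, q) \<in> (adj F)\<^sup>*"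
proof -
  have "sym (adj F)" using sym_adj[of F UNIV] by simp
  then show ?thesis using assms sym_rtrancl by (meson rtrancl_trans symD)
qed

text \<open>A climb to the root never uses an edge within one level, so both ends would reach the
  root without it: a detour.\<close>

lemma depth_edge_neq:
  assumes "{p, q} \<in> E"
  shows "depth E p \<noteq> depth E q"
proof
  assume eq: "depth E p = depth E q"
  have F: "{x, y} \<in> E - {{p, q}}" if "{x, y} \<in> E" "depth E y = Suc (depth E x)" for x y
    using that eq by (auto simp: doubleton_eq_iff)
  have "(p, 0) \<in> (adj (E - {{p, q}}))\<^sup>*" "(q, 0) \<in> (adj (E - {{p, q}}))\<^sup>*"
    using edge_less[OF tree assms] by (auto intro!: path_to_root F)
  then show False using connected_via_root no_detour[OF tree assms] by blast
qed

text \<open>Both parents reach the root through smaller depths, hence without the edge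
  \<open>{p, q}\<close>; going on from \<open>p'\<close> to \<open>q\<close> completes a
  detour.\<close>

lemma parent_unique:
  assumes "q \<in> children E p" "q \<in> children E p'"
  shows "p = p'"
proof (rule ccontr)
  assume ne: "p \<noteq> p'"
  let ?F = "E - {{p, q}}"
  have e: "{p, q} \<in> E" "{p', q} \<in> E" and d: "depth E q = Suc (depth E p)" "depth E p' = depth E p"
    using assms by (auto simp: children_def)
  have F: "{x, y} \<in> ?F" if "{x, y} \<in> E" "depth E y = Suc (depth E x)" "depth E y \<le> depth E p" for x y
    using that d by (auto simp: doubleton_eq_iff)
  have "(p, 0) \<in> (adj ?F)\<^sup>*"
    by (rule path_to_root[OF edge_less(1)[OF tree e(1)]]) (rule F)
  moreover have "(p', 0) \<in> (adj ?F)\<^sup>*"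
    by (rule path_to_root[OF edge_less(1)[OF tree e(2)]]) (rule F, simp_all only: d)
  ultimately have "(p, p') \<in> (adj ?F)\<^sup>*" by (rule connected_via_root)
  moreover have "(p', q) \<in> adj ?F" using e ne by (auto simp: adj_def doubleton_eq_iff)
  ultimately have "(p, q) \<in> (adj ?F)\<^sup>*" by (rule rtrancl_into_rtrancl)
  then show False using no_detour[OF tree e(1)] by blast
qed

section \<open>Words as addresses of vertices\<close>

definition lab :: "nat list \<Rightarrow> nat" where
  "lab u = the (descend E 0 u)"

abbreviation "\<tau> \<equiv> shape E"

lemma finite_children_set [simp]: "finite (children E p)"
  using children_less[OF tree] finite_subset by blast

lemma descend_lab: "u \<in> \<tau> \<Longrightarrow> descend E 0 u = Some (lab u)"
  by (auto simp: shape_def lab_def)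

lemma lab_Nil [simp]: "lab [] = 0"
  by (simp add: lab_def)

lemma Nil_in_shape [simp]: "[] \<in> \<tau>"
  by (simp add: shape_def)

lemma snoc_in_shape: "u @ [i] \<in> \<tau> \<longleftrightarrow> u \<in> \<tau> \<and> i < card (children E (lab u))"
  by (auto simp: shape_def lab_def descend_snoc split: option.splits if_splits)

lemma lab_snoc:
  assumes "u @ [i] \<in> \<tau>"
  shows "lab (u @ [i]) = sorted_list_of_set (children E (lab u)) ! i"
proof -
  have "descend E 0 (u @ [i]) = Some (sorted_list_of_set (children E (lab u)) ! i)"
    using assms descend_lab[of u] by (simp add: snoc_in_shape descend_snoc)
  then show ?thesis using descend_lab[OF assms] by simp
qed

lemma lab_snoc_in_children: "u @ [i] \<in> \<tau> \<Longrightarrow> lab (u @ [i]) \<in> children E (lab u)"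
  using nth_children[OF tree] by (auto simp: lab_snoc snoc_in_shape)

lemma lab_snoc_strict_mono:
  assumes "u @ [j] \<in> \<tau>" "i < j"
  shows "lab (u @ [i]) < lab (u @ [j])"
proof -
  have "u @ [i] \<in> \<tau>" using assms by (auto simp: snoc_in_shape)
  then show ?thesis
    using assms sorted_wrt_nth_less[OF strict_sorted_list_of_set, of i j "children E (lab u)"]
    by (auto simp: lab_snoc snoc_in_shape)
qed

lemma lab_less: "u \<in> \<tau> \<Longrightarrow> lab u < n"
  and depth_lab: "u \<in> \<tau> \<Longrightarrow> depth E (lab u) = length u"
  using descend_bounds[OF tree descend_lab] pos by auto

lemma lab_inject:
  assumes "u \<in> \<tau>" "v \<in> \<tau>" "lab u = lab v"
  shows "u = v"
  using assms
proof (induction u arbitrary: v rule: rev_induct)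
  case Nil
  then show ?case using depth_lab[of v] depth_lab[of "[]"] by simp
next
  case (snoc i u)
  then have "length v = Suc (length u)" using depth_lab[of v] depth_lab[of "u @ [i]"] by simp
  then obtain v' j where v: "v = v' @ [j]" by (cases v rule: rev_cases) auto
  have "lab (u @ [i]) \<in> children E (lab u)" "lab (u @ [i]) \<in> children E (lab v')"
    using lab_snoc_in_children[of u i] lab_snoc_in_children[of v' j] snoc.prems v by auto
  then have "lab u = lab v'" by (rule parent_unique)
  then have uv: "u = v'" using snoc v by (auto simp: snoc_in_shape)
  then have "i = j"
    using lab_snoc_strict_mono[of u i j] lab_snoc_strict_mono[of u j i] snoc.prems v
    by (cases i j rule: linorder_cases) auto
  with uv v show ?case by simp
qed

lemma child_word:
  assumes "u \<in> \<tau>" "q \<in> children E (lab u)"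
  obtains i where "u @ [i] \<in> \<tau>" "lab (u @ [i]) = q"
proof -
  obtain i where "i < card (children E (lab u))" "sorted_list_of_set (children E (lab u)) ! i = q"
    using assms(2) in_set_conv_nth[of q "sorted_list_of_set (children E (lab u))"] by auto
  then show thesis using that[of i] assms(1) by (simp add: lab_snoc snoc_in_shape)
qed

lemma lab_surj:
  assumes "q < n"
  shows "\<exists>u\<in>\<tau>. lab u = q"
  using assms
proof (induction "depth E q" arbitrary: q rule: less_induct)
  case less
  show ?case
  proof (cases "q = 0")
    case True
    then show ?thesis by (intro bexI[of _ "[]"]) auto
  next
    case False
    then obtain p where p: "q \<in> children E p" "p < n" using parent_exists less.prems by blast
    then obtain u where "u \<in> \<tau>" "lab u = p" using less.hyps[of p] by (auto simp: children_def)
    then show ?thesis using p child_word[of u q] by metis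
  qed
qed

lemma bij_betw_lab: "bij_betw lab \<tau> {..<n}"
  unfolding bij_betw_def
proof
  show "inj_on lab \<tau>" using lab_inject by (auto intro!: inj_onI)
  show "lab ` \<tau> = {..<n}" using lab_surj lab_less by (fastforce simp: image_iff)
qed

lemma card_shape: "card \<tau> = n"
  using bij_betw_same_card[OF bij_betw_lab] by simp

lemma edge_words:
  assumes "{p, q} \<in> E"
  obtains v i where "v @ [i] \<in> \<tau>" "{p, q} = {lab v, lab (v @ [i])}"
proof -
  have *: "\<exists>v i. v @ [i] \<in> \<tau> \<and> {p, q} = {lab v, lab (v @ [i])}"
    if e: "{p, q} \<in> E" and d: "depth E q = Suc (depth E p)" for p q
  proof -
    obtain v where v: "v \<in> \<tau>" "lab v = p" using lab_surj edge_less[OF tree e] by blast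
    moreover have "q \<in> children E (lab v)" using e d v by (simp add: children_def)
    ultimately obtain i where "v @ [i] \<in> \<tau>" "lab (v @ [i]) = q" using child_word by blast
    then show ?thesis using v by blast
  qed
  have e: "{q, p} \<in> E" using assms by (simp add: insert_commute)
  consider "depth E q = Suc (depth E p)" | "depth E p = Suc (depth E q)"
    using depth_edge_le[OF assms] depth_edge_le[OF e] depth_edge_neq[OF assms] by linarith
  then have "\<exists>v i. v @ [i] \<in> \<tau> \<and> {p, q} = {lab v, lab (v @ [i])}"
    using *[OF assms] *[OF e] by cases (auto simp: insert_commute)
  then show thesis using that by blast
qed

lemma edge_of_words: "v @ [i] \<in> \<tau> \<Longrightarrow> {lab v, lab (v @ [i])} \<in> E"
  using lab_snoc_in_children by (simp add: children_def)

sublocale finite_plane_tree \<tau>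
  by unfold_locales (rule plane_tree_shape[OF tree pos])

text \<open>The path is confined to the labels of the subtree because
  \<open>paths_not_interleaved\<close> asks for paths through disjoint sets.\<close>

lemma subtree_connected:
  assumes "v \<in> \<tau>" "prefix u v"
  shows "(lab u, lab v) \<in> (adj E \<inter> lab ` {v \<in> \<tau>. prefix u v} \<times> lab ` {v \<in> \<tau>. prefix u v})\<^sup>*"
  using assms
proof (induction v rule: rev_induct)
  case (snoc i v)
  show ?case
  proof (cases "u = v @ [i]")
    case False
    then have "prefix u v" "v \<in> \<tau>" using snoc.prems by (auto simp: snoc_in_shape)
    then show ?thesis
      using snoc edge_of_words[OF snoc.prems(1)] by (auto simp: adj_def intro: rtrancl_into_rtrancl)
  qed simp
qed simp

text \<open>The words outside the subtree of \<open>u\<close> are closed under taking parents, so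
  the way to the root never enters the subtree.\<close>

lemma complement_connected:
  assumes "v \<in> \<tau>" "\<not> prefix u v"
  shows "(0, lab v) \<in> (adj E \<inter> lab ` {v \<in> \<tau>. \<not> prefix u v} \<times> lab ` {v \<in> \<tau>. \<not> prefix u v})\<^sup>*"
  using assms
proof (induction v rule: rev_induct)
  case (snoc i v)
  then have "\<not> prefix u v" "v \<in> \<tau>" by (auto simp: snoc_in_shape)
  then show ?case
    using snoc edge_of_words[OF snoc.prems(1)] by (auto simp: adj_def intro: rtrancl_into_rtrancl)
qed simp

text \<open>The root has the smallest label, 0. If \<open>m\<close> were not below \<open>u\<close>,
  a path from 0 to \<open>lab m\<close> outside the subtree and a path from \<open>lab x\<close> to
  \<open>lab y\<close> inside it would have interleaved ends.\<close>

lemma subtree_interval: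
  assumes nc: "noncrossing_tree n E"
    and x: "x \<in> \<tau>" "prefix u x" and y: "y \<in> \<tau>" "prefix u y" and m: "m \<in> \<tau>"
    and less: "lab x < lab m" "lab m < lab y"
  shows "prefix u m"
proof (rule ccontr)
  assume n: "\<not> prefix u m"
  let ?D = "lab ` {v \<in> \<tau>. prefix u v}" and ?C = "lab ` {v \<in> \<tau>. \<not> prefix u v}"
  have "u \<noteq> []" using n by auto
  then have "x \<noteq> []" using x by auto
  then have "lab x \<noteq> 0" using lab_inject[OF x(1) Nil_in_shape] by auto
  have disj: "?D \<inter> ?C = {}" using lab_inject by blast
  have "(lab x, lab u) \<in> (adj E \<inter> ?D \<times> ?D)\<^sup>*"
    using subtree_connected[OF x] sym_rtrancl[OF sym_adj] by (blast dest: symD)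
  then have "(lab x, lab y) \<in> (adj E \<inter> ?D \<times> ?D)\<^sup>*"
    using subtree_connected[OF y] by (rule rtrancl_trans)
  then show False
    using paths_not_interleaved[OF nc disj _ _ complement_connected[OF m n]] x less \<open>lab x \<noteq> 0\<close>
    by auto
qed

text \<open>Subtrees of siblings occupy disjoint intervals of labels, ordered like the labels of the
  siblings and hence like their positions. A vertex is not in the subtree of its own child, so it
  lies outside that interval.\<close>

lemma labelled_tree_shape:
  assumes nc: "noncrossing_tree n E"
  shows "labelled_tree \<tau> lab"
proof unfold_locales
  show "bij_betw lab \<tau> {..<card \<tau>}" using bij_betw_lab card_shape by simp
next
  fix u v assume uv: "u \<in> \<tau>" "v \<in> \<tau>" "u \<parallel> v" "u < v"
  obtain w i j a b where w: "u = w @ i # a" "v = w @ j # b" "i < j"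
    using parallel_less_decomp[OF uv(3,4)] .
  have pu: "prefix (w @ [i]) u" and pv: "prefix (w @ [j]) v" using w by auto
  have it: "w @ [i] \<in> \<tau>" and jt: "w @ [j] \<in> \<tau>"
    using prefix_in_tree[OF uv(1) pu] prefix_in_tree[OF uv(2) pv] by auto
  have npij: "\<not> prefix (w @ [i]) (w @ [j])" "\<not> prefix (w @ [j]) (w @ [i])"
    "\<not> prefix (w @ [j]) u" "\<not> prefix (w @ [i]) v" using w by auto
  have less: "lab (w @ [i]) < lab (w @ [j])" using lab_snoc_strict_mono[OF jt w(3)] .
  show "lab u < lab v"
  proof (rule ccontr)
    assume "\<not> lab u < lab v"
    then have vu: "lab v < lab u" using lab_inject[OF uv(1,2)] uv(4) by fastforce
    consider "lab v < lab (w @ [i])" | "lab v = lab (w @ [i])" | "lab (w @ [i]) < lab v"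
      by linarith
    then show False
    proof cases
      case 1
      then show False
        using subtree_interval[OF nc uv(2) pv jt _ it] less npij by auto
    next
      case 2
      then show False using lab_inject[OF uv(2) it] npij pv by auto
    next
      case 3
      then show False
        using subtree_interval[OF nc it _ uv(1) pu uv(2)] vu npij by auto
    qed
  qed
next
  fix v v' u i
  assume v: "v \<in> \<tau>" "v' \<in> \<tau>" "prefix (u @ [i]) v" "prefix (u @ [i]) v'" "lab u < lab v"
  have ut: "u \<in> \<tau>" using prefix_in_tree[OF v(1,3)] by (simp add: snoc_in_shape)
  have np: "\<not> prefix (u @ [i]) u" by (auto dest: prefix_length_le)
  show "lab u < lab v'"
  proof (rule ccontr)
    assume "\<not> lab u < lab v'"
    moreover have "lab u \<noteq> lab v'" using lab_inject[OF ut v(2)] v(4) np by auto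
    ultimately have "lab v' < lab u" by simp
    then show False using subtree_interval[OF nc v(2,4) v(1,3) ut] v(5) np by simp
  qed
qed

end

section \<open>Coded pairs\<close>

text \<open>Pointwise inequalities instead of an infimum: they pass to limits and can be relaxed by
  an error term.\<close>

definition coded_pairs :: "(real \<Rightarrow> real) \<Rightarrow> (real \<times> real) set" where
  "coded_pairs f = {(s, t). s \<in> {0..1} \<and> t \<in> {0..1} \<and>
     (\<forall>r\<in>{min s t..max s t}. f s \<le> f r \<and> f t \<le> f r)}"

lemma coded_pairs_commute: "(s, t) \<in> coded_pairs f \<Longrightarrow> (t, s) \<in> coded_pairs f"
  by (auto simp: coded_pairs_def min.commute max.commute)

lemma coded_pairs_eq:
  assumes "(s, t) \<in> coded_pairs f"
  shows "f s = f t"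
proof -
  have "s \<in> {min s t..max s t}" "t \<in> {min s t..max s t}" by auto
  then show ?thesis using assms unfolding coded_pairs_def by (metis (mono_tags, lifting) antisym case_prodD mem_Collect_eq)
qed

lemma coded_pairs_refl: "s \<in> {0..1} \<Longrightarrow> (s, s) \<in> coded_pairs f"
  by (auto simp: coded_pairs_def)

lemma coded_equiv_iff:
  assumes nonneg: "\<And>s. s \<in> {0..1} \<Longrightarrow> 0 \<le> f s" and st: "s \<in> {0..1}" "t \<in> {0..1}"
  shows "coded_equiv f s t \<longleftrightarrow> (s, t) \<in> coded_pairs f"
proof
  let ?I = "{min s t..max s t}"
  have I: "?I \<subseteq> {0..1}" using st by auto
  assume c: "coded_equiv f s t"
  have "bdd_below (f ` ?I)" using I nonneg by (intro bdd_belowI[of _ 0]) blast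
  then have "(INF r\<in>?I. f r) \<le> f r" if "r \<in> ?I" for r using that by (rule cINF_lower)
  then show "(s, t) \<in> coded_pairs f" using c st by (auto simp: coded_equiv_def coded_pairs_def)
next
  assume c: "(s, t) \<in> coded_pairs f"
  then have "(INF r\<in>{min s t..max s t}. f r) = f t"
    by (intro cInf_eq_minimum) (auto simp: coded_pairs_def)
  then show "coded_equiv f s t" using coded_pairs_eq[OF c] by (simp add: coded_equiv_def)
qed

lemma lamination_eq:
  assumes "\<And>s. s \<in> {0..1} \<Longrightarrow> 0 \<le> f s"
  shows "lamination f = (\<Union>(s, t)\<in>coded_pairs f. closed_segment (circ s) (circ t))"
proof -
  have "s \<in> {0..1} \<and> t \<in> {0..1} \<and> coded_equiv f s t \<longleftrightarrow> (s, t) \<in> coded_pairs f" for s t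
    using coded_equiv_iff[of f s t] assms by (auto simp: coded_pairs_def)
  then show ?thesis by (force simp: lamination_def)
qed

text \<open>The error \<open>d k\<close> lets one lemma serve twice: with \<open>d = 0\<close> for
  closedness, and with a null sequence for \<open>almost_coded_pairs\<close>.\<close>

lemma coded_pairs_limit:
  fixes s t :: real
  assumes f: "continuous_on {0..1} f" and S: "S \<longlonglongrightarrow> s" and T: "T \<longlonglongrightarrow> t" and d: "d \<longlonglongrightarrow> 0"
    and ST: "\<And>k. S k \<in> {0..1}" "\<And>k. T k \<in> {0..1}"
    and le: "\<And>k r. r \<in> {min (S k) (T k)..max (S k) (T k)} \<Longrightarrow> f (S k) \<le> f r + d k \<and> f (T k) \<le> f r + d k"
  shows "(s, t) \<in> coded_pairs f"
proof -
  have s: "s \<in> {0..1}" and t: "t \<in> {0..1}"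
    using closed_sequentially[of "{0..1}" S s] closed_sequentially[of "{0..1}" T t] S T ST by auto
  have lim: "(\<lambda>k. f (X k)) \<longlonglongrightarrow> f x" if "X \<longlonglongrightarrow> x" "\<And>k. X k \<in> {0..1}" "x \<in> {0..1}" for X x
    using continuous_on_tendsto_compose[OF f that(1,3)] that(2) by simp
  have "f s \<le> f r \<and> f t \<le> f r" if r: "r \<in> {min s t..max s t}" for r
  proof -
    \<comment> \<open>The projection of \<open>r\<close> onto the interval of the
      \<open>k\<close>-th pair; as these intervals converge, it tends to \<open>r\<close>.\<close>
    define R where "R k = max (min (S k) (T k)) (min r (max (S k) (T k)))" for k
    have "R \<longlonglongrightarrow> max (min s t) (min r (max s t))"
      unfolding R_def by (intro tendsto_max tendsto_min S T tendsto_const)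
    then have Rr: "R \<longlonglongrightarrow> r" using r by (simp add: max_def min_def split: if_splits)
    have Rk: "R k \<in> {min (S k) (T k)..max (S k) (T k)}" for k
      by (auto simp: R_def)
    have "R k \<in> {0..1}" for k using Rk[of k] ST[of k] by (auto simp: min_def max_def split: if_splits)
    moreover have "r \<in> {0..1}" using r s t by (auto simp: min_def max_def split: if_splits)
    ultimately have "(\<lambda>k. f (R k)) \<longlonglongrightarrow> f r" using lim Rr by blast
    then have Rd: "(\<lambda>k. f (R k) + d k) \<longlonglongrightarrow> f r" using tendsto_add[OF _ d] by force
    show ?thesis
      using LIMSEQ_le[OF lim[OF S ST(1) s] Rd] LIMSEQ_le[OF lim[OF T ST(2) t] Rd] le[OF Rk] by blast
  qed
  then show ?thesis using s t by (auto simp: coded_pairs_def)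
qed

lemma compact_coded_pairs:
  assumes "continuous_on {0..1} f"
  shows "compact (coded_pairs f)"
proof -
  have "closed (coded_pairs f)"
    unfolding closed_sequential_limits
  proof (intro allI impI)
    fix X :: "nat \<Rightarrow> real \<times> real" and l
    assume X: "(\<forall>k. X k \<in> coded_pairs f) \<and> X \<longlonglongrightarrow> l"
    have *: "(fst (X k), snd (X k)) \<in> coded_pairs f" for k using X by simp
    have X01: "fst (X k) \<in> {0..1}" "snd (X k) \<in> {0..1}" for k
      using *[of k] by (auto simp: coded_pairs_def)
    have le: "f (fst (X k)) \<le> f r + 0 \<and> f (snd (X k)) \<le> f r + 0"
      if "r \<in> {min (fst (X k)) (snd (X k))..max (fst (X k)) (snd (X k))}" for k r
      using *[of k] that by (simp add: coded_pairs_def split_beta)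
    have "(fst l, snd l) \<in> coded_pairs f"
      by (rule coded_pairs_limit[OF assms _ _ tendsto_const X01 le])
         (use X in \<open>auto intro: tendsto_fst tendsto_snd\<close>)
    then show "l \<in> coded_pairs f" by simp
  qed
  moreover have "bounded (coded_pairs f)"
    by (rule bounded_subset[of "{0..1} \<times> {0..1}"]) (auto simp: coded_pairs_def bounded_Times)
  ultimately show ?thesis by (simp add: compact_eq_bounded_closed)
qed

text \<open>If pairs with errors tending to 0 stayed away from all coded pairs, a limit of a
  subsequence would itself be a coded pair.\<close>

lemma almost_coded_pairs:
  assumes f: "continuous_on {0..1} f" and "e > 0"
  obtains d where "d > 0"
    "\<And>s t. s \<in> {0..1} \<Longrightarrow> t \<in> {0..1} \<Longrightarrow>
       (\<And>r. r \<in> {min s t..max s t} \<Longrightarrow> f s \<le> f r + d \<and> f t \<le> f r + d) \<Longrightarrow>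
       \<exists>(s', t')\<in>coded_pairs f. \<bar>s - s'\<bar> < e \<and> \<bar>t - t'\<bar> < e"
proof -
  define ok where "ok d s t \<longleftrightarrow> (\<forall>r\<in>{min s t..max s t}. f s \<le> f r + d \<and> f t \<le> f r + d)" for d s t
  define close where "close s t \<longleftrightarrow> (\<exists>(s', t')\<in>coded_pairs f. \<bar>s - s'\<bar> < e \<and> \<bar>t - t'\<bar> < e)" for s t
  have "\<exists>d>0. \<forall>s\<in>{0..1}. \<forall>t\<in>{0..1}. ok d s t \<longrightarrow> close s t"
  proof (rule ccontr)
    assume n: "\<not> ?thesis"
    have "\<exists>p. fst p \<in> {0..1} \<and> snd p \<in> {0..1} \<and> ok (1 / real (Suc k)) (fst p) (snd p) \<and>
      \<not> close (fst p) (snd p)" for k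
    proof -
      have "1 / real (Suc k) > 0" by simp
      then obtain s t where "s \<in> {0..1}" "t \<in> {0..1}" "ok (1 / real (Suc k)) s t" "\<not> close s t"
        using n by blast
      then show ?thesis by (intro exI[of _ "(s, t)"]) simp
    qed
    then obtain P where P: "\<And>k. fst (P k) \<in> {0..1}" "\<And>k. snd (P k) \<in> {0..1}"
      "\<And>k. ok (1 / real (Suc k)) (fst (P k)) (snd (P k))" "\<And>k. \<not> close (fst (P k)) (snd (P k))"
      by metis
    have "compact ({0..1} \<times> {0..1} :: (real \<times> real) set)" by (intro compact_Times compact_Icc)
    moreover have "\<forall>k. P k \<in> {0..1} \<times> {0..1}" using P(1,2) by (simp add: mem_Times_iff)
    ultimately obtain l \<phi> where l: "strict_mono \<phi>" "(P \<circ> \<phi>) \<longlonglongrightarrow> l"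
      by (metis seq_compactE compact_imp_seq_compact)
    have d: "(\<lambda>k. 1 / real (Suc (\<phi> k))) \<longlonglongrightarrow> 0"
      using LIMSEQ_subseq_LIMSEQ[OF LIMSEQ_inverse_real_of_nat l(1)] by (simp add: o_def field_simps)
    have lim: "(\<lambda>k. fst (P (\<phi> k))) \<longlonglongrightarrow> fst l" "(\<lambda>k. snd (P (\<phi> k))) \<longlonglongrightarrow> snd l"
      using tendsto_fst[OF l(2)] tendsto_snd[OF l(2)] by (auto simp: o_def)
    have "(fst l, snd l) \<in> coded_pairs f"
      by (rule coded_pairs_limit[OF f lim d P(1,2)]) (use P(3) in \<open>auto simp: ok_def\<close>)
    moreover have "\<forall>\<^sub>F k in sequentially. \<bar>fst (P (\<phi> k)) - fst l\<bar> < e \<and> \<bar>snd (P (\<phi> k)) - snd l\<bar> < e"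
      using tendstoD[OF lim(1) \<open>e > 0\<close>] tendstoD[OF lim(2) \<open>e > 0\<close>]
      by (simp add: dist_real_def eventually_conj)
    then obtain k where "\<bar>fst (P (\<phi> k)) - fst l\<bar> < e \<and> \<bar>snd (P (\<phi> k)) - snd l\<bar> < e"
      using eventually_happens'[OF sequentially_bot] by blast
    ultimately show False using P(4)[of "\<phi> k"] by (auto simp: close_def)
  qed
  then obtain d where "d > 0" "\<And>s t. s \<in> {0..1} \<Longrightarrow> t \<in> {0..1} \<Longrightarrow> ok d s t \<Longrightarrow> close s t" by blast
  then show thesis using that[of d] unfolding ok_def close_def by blast
qed

section \<open>Strictly dominated intervals\<close>

lemma last_level:
  fixes f :: "real \<Rightarrow> real"
  assumes f: "continuous_on {p..q} f" and "p \<le> q" "f p \<le> h" "h < f q"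
  obtains c where "p \<le> c" "c < q" "f c = h" "\<And>s. c < s \<Longrightarrow> s \<le> q \<Longrightarrow> h < f s"
proof -
  define S where "S = {p..q} \<inter> f -` {..h}"
  have "closed S" unfolding S_def by (rule continuous_closed_preimage[OF f]) auto
  moreover have "bounded S" by (rule bounded_subset[of "{p..q}"]) (auto simp: S_def)
  ultimately have "compact S" by (simp add: compact_eq_bounded_closed)
  moreover have "S \<noteq> {}" using assms by (auto simp: S_def)
  ultimately obtain c where c: "c \<in> S" "\<And>s. s \<in> S \<Longrightarrow> s \<le> c" by (metis compact_attains_sup)
  have after: "h < f s" if "c < s" "s \<le> q" for s
    using c(2)[of s] c(1) that by (force simp: S_def)
  have "c \<noteq> q" using c(1) assms(4) by (auto simp: S_def)
  then have cq: "p \<le> c" "c < q" "f c \<le> h" using c(1) by (auto simp: S_def)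
  obtain s where s: "c \<le> s" "s \<le> q" "f s = h"
    using IVT'[of f c h q] cq assms(4) continuous_on_subset[OF f] by force
  then have "f c = h" using after[of s] by (cases "c = s") auto
  then show thesis using that[OF cq(1,2)] after by blast
qed

lemma first_level:
  fixes f :: "real \<Rightarrow> real"
  assumes f: "continuous_on {p..q} f" and "p \<le> q" "h < f p" "f q \<le> h"
  obtains c where "p < c" "c \<le> q" "f c = h" "\<And>s. p \<le> s \<Longrightarrow> s < c \<Longrightarrow> h < f s"
proof -
  have "continuous_on {-q..-p} (\<lambda>s. f (- s))"
    by (rule continuous_on_compose2[OF f]) (auto intro: continuous_intros)
  then obtain c where c: "- q \<le> c" "c < - p" "f (- c) = h" "\<And>s. c < s \<Longrightarrow> s \<le> - p \<Longrightarrow> h < f (- s)"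
    using last_level[of "-q" "-p" "\<lambda>s. f (- s)" h] assms by auto
  show thesis using that[of "- c"] c(1-3) c(4)[of "- _"] by (metis add.inverse_inverse minus_le_iff minus_less_iff)
qed

text \<open>The gap between the larger outer value and the minimum of \<open>f\<close> on
  \<open>{a..b}\<close> is cut into three parts of size \<open>g\<close>; \<open>a1\<close>,
  \<open>a2\<close> and \<open>b1\<close> are crossings of the two intermediate levels. On the right
  \<open>b1\<close> serves both intervals, since \<open>edge_across\<close> requires a gap between
  its two levels on the left only.\<close>

lemma two_levels:
  fixes f :: "real \<Rightarrow> real"
  assumes f: "continuous_on {a0..b0} f" and "a0 < a" "a \<le> b" "b < b0"
    and less: "\<And>r. r \<in> {a..b} \<Longrightarrow> f a0 < f r \<and> f b0 < f r"
  obtains a1 a2 b1 g where "g > 0" "a0 < a1" "a1 < a2" "a2 < a" "b < b1" "b1 < b0"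
    "\<And>r. r \<in> {a1..b1} \<Longrightarrow> f a0 + g \<le> f r \<and> f b0 + g \<le> f r"
    "\<And>r. r \<in> {a..b} \<Longrightarrow> f a2 + g \<le> f r \<and> f b1 + g \<le> f r"
proof -
  have "compact {a..b}" "{a..b} \<noteq> {}" "continuous_on {a..b} f"
    using assms by (auto intro: continuous_on_subset[OF f])
  then obtain m where m: "m \<in> {a..b}" "\<And>r. r \<in> {a..b} \<Longrightarrow> f m \<le> f r"
    by (metis continuous_attains_inf)
  define l where "l = max (f a0) (f b0)"
  have lm: "l < f m" using less[OF m(1)] by (simp add: l_def)
  define g where "g = (f m - l) / 3"
  define h1 where "h1 = l + g"
  define h2 where "h2 = l + 2 * g"
  have g: "g > 0" using lm by (simp add: g_def)
  have fm: "f m = l + 3 * g" by (simp add: g_def field_simps)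
  have ma: "f m \<le> f a" "f m \<le> f b" using m(2) assms by auto
  obtain a1 where a1: "a0 \<le> a1" "a1 < a" "f a1 = h1" "\<And>s. a1 < s \<Longrightarrow> s \<le> a \<Longrightarrow> h1 < f s"
    by (rule last_level[of a0 a f h1])
       (use assms g fm ma in \<open>auto simp: h1_def l_def intro: continuous_on_subset[OF f]\<close>)
  obtain a2 where a2: "a1 \<le> a2" "a2 < a" "f a2 = h2"
    by (rule last_level[of a1 a f h2])
       (use assms g fm ma a1 in \<open>auto simp: h1_def h2_def intro: continuous_on_subset[OF f]\<close>)
  obtain b1 where b1: "b < b1" "b1 \<le> b0" "f b1 = h2" "\<And>s. b \<le> s \<Longrightarrow> s < b1 \<Longrightarrow> h2 < f s"
    by (rule first_level[of b b0 f h2])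
       (use assms g fm ma in \<open>auto simp: h2_def l_def intro: continuous_on_subset[OF f]\<close>)
  have "a0 \<noteq> a1" using a1(3) g by (auto simp: h1_def l_def)
  moreover have "a1 \<noteq> a2" using a1(3) a2(3) g by (auto simp: h1_def h2_def)
  moreover have "b1 \<noteq> b0" using b1(3) g by (auto simp: h2_def l_def)
  moreover have "h1 \<le> f r" if r: "r \<in> {a1..b1}" for r
  proof -
    consider "r = a1" | "a1 < r" "r \<le> a" | "r \<in> {a..b}" | "b \<le> r" "r < b1" | "r = b1"
      using r by (cases "r = a1"; cases "r = b1"; cases "r \<le> a"; cases "b \<le> r") auto
    then show ?thesis
    proof cases
      case 2
      then show ?thesis using a1(4)[of r] by simp
    next
      case 3
      then show ?thesis using m(2)[of r] fm g by (simp add: h1_def)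
    next
      case 4
      then show ?thesis using b1(4)[of r] g by (simp add: h1_def h2_def)
    qed (use a1 b1 g in \<open>auto simp: h1_def h2_def\<close>)
  qed
  then have "f a0 + g \<le> f r \<and> f b0 + g \<le> f r" if "r \<in> {a1..b1}" for r
    using that unfolding h1_def l_def by fastforce
  moreover have "f a2 + g \<le> f r \<and> f b1 + g \<le> f r" if "r \<in> {a..b}" for r
    using m(2)[OF that] fm a2(3) b1(3) by (simp add: h2_def)
  ultimately show thesis
    using that[of g a1 a2 b1] g a1 a2 b1 by simp
qed

locale lamination_coding =
  fixes f :: "real \<Rightarrow> real"
  assumes f_cont: "continuous_on {0..1} f"
    and f_nonneg: "\<And>s. s \<in> {0..1} \<Longrightarrow> 0 \<le> f s"
    and f_ends: "f 0 = 0" "f 1 = 0"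
    and f_minima: "distinct_local_minima f"
begin

lemma inf_attained_at:
  assumes "a < x" "x < b" "\<And>y. a < y \<Longrightarrow> y < b \<Longrightarrow> f x \<le> f y"
  shows "inf_attained f a b" "(INF y\<in>{a<..<b}. f y) = f x"
proof -
  show "(INF y\<in>{a<..<b}. f y) = f x"
    by (rule cInf_eq_minimum) (use assms in auto)
  then show "inf_attained f a b" using assms by (force simp: inf_attained_def)
qed

lemma local_minima_neq:
  assumes "0 \<le> a" "a < x" "x < b" "b < c" "c < y" "y < d" "d \<le> 1"
    and "\<And>s. a < s \<Longrightarrow> s < b \<Longrightarrow> f x \<le> f s" "\<And>s. c < s \<Longrightarrow> s < d \<Longrightarrow> f y \<le> f s"
  shows "f x \<noteq> f y"
proof -
  have "(INF y\<in>{a<..<b}. f y) \<noteq> (INF y\<in>{c<..<d}. f y)"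
    using f_minima[unfolded distinct_local_minima_def, rule_format, of a b c d]
      inf_attained_at(1)[OF assms(2,3,8)] inf_attained_at(1)[OF assms(5,6,9)] assms(1-7) by simp
  then show ?thesis using inf_attained_at(2)[OF assms(2,3,8)] inf_attained_at(2)[OF assms(5,6,9)] by simp
qed

lemma less_near:
  assumes "x \<in> {0..1}" "f x < c"
  obtains d where "d > 0" "\<And>r. r \<in> {0..1} \<Longrightarrow> \<bar>r - x\<bar> < d \<Longrightarrow> f r < c"
proof -
  obtain d where "d > 0" "\<forall>r\<in>{0..1}. dist r x < d \<longrightarrow> dist (f r) (f x) < c - f x"
    using f_cont assms unfolding continuous_on_iff by (metis diff_gt_0_iff_gt)
  then show thesis using that[of d] by (fastforce simp: dist_real_def)
qed

text \<open>If \<open>f\<close> exceeds the common value strictly inside, the interval can be shrunk slightly. Otherwise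
  this value is attained at an inner local minimum, hence at no other local minimum, and \<open>f\<close> takes
  smaller values immediately outside.\<close>

lemma dominated_near:
  assumes c: "(x, y) \<in> coded_pairs f" and "x < y" and ne: "\<not> (x = 0 \<and> y = 1)" and e: "e > 0"
  obtains a0 a b b0 where "0 \<le> a0" "a0 < a" "a \<le> b" "b < b0" "b0 < 1"
    "\<And>r. r \<in> {a..b} \<Longrightarrow> f a0 < f r \<and> f b0 < f r"
    "x - e < a0" "a < x + e" "y - e < b" "b0 < y + e"
proof -
  have xy: "x \<in> {0..1}" "y \<in> {0..1}" and fxy: "f x = f y"
    and min: "\<And>r. x \<le> r \<Longrightarrow> r \<le> y \<Longrightarrow> f x \<le> f r"
    using c \<open>x < y\<close> coded_pairs_eq[OF c] by (auto simp: coded_pairs_def)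
  show thesis
  proof (cases "\<exists>r. x < r \<and> r < y \<and> f r = f x")
    case False
    then have gt: "f x < f r" if "x < r" "r < y" for r using min[of r] that by force
    define \<eta> where "\<eta> = min (e / 2) ((y - x) / 2)"
    have \<eta>: "0 < \<eta>" "\<eta> < e" "x + \<eta> \<le> y - \<eta>" using e \<open>x < y\<close> by (auto simp: \<eta>_def min_def field_simps)
    have "compact {x + \<eta>..y - \<eta>}" "{x + \<eta>..y - \<eta>} \<noteq> {}" "continuous_on {x + \<eta>..y - \<eta>} f"
      using \<eta> xy by (auto intro: continuous_on_subset[OF f_cont])
    then obtain m where m: "m \<in> {x + \<eta>..y - \<eta>}" "\<And>r. r \<in> {x + \<eta>..y - \<eta>} \<Longrightarrow> f m \<le> f r"
      by (metis continuous_attains_inf)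
    have fm: "f x < f m" "f y < f m" using gt[of m] m(1) \<eta> fxy by auto
    obtain d where d: "d > 0" "\<And>r. r \<in> {0..1} \<Longrightarrow> \<bar>r - x\<bar> < d \<Longrightarrow> f r < f m"
      using less_near[OF xy(1) fm(1)] by blast
    obtain d' where d': "d' > 0" "\<And>r. r \<in> {0..1} \<Longrightarrow> \<bar>r - y\<bar> < d' \<Longrightarrow> f r < f m"
      using less_near[OF xy(2) fm(2)] by blast
    \<comment> \<open>Within \<open>k\<close> of \<open>x\<close> and of \<open>y\<close> inside
      \<open>{0..1}\<close>, \<open>f\<close> is below its minimum \<open>f m\<close> over the inner
      interval.\<close>
    define k where "k = min \<eta> (min d d') / 2"
    have k: "0 < k" "k < \<eta>" "k < d" "k < d'" using \<eta> d d' by (auto simp: k_def min_def)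
    have "f (x + k) < f m" "f (y - k) < f m"
      using d(2)[of "x + k"] d'(2)[of "y - k"] k \<eta> xy by auto
    then show thesis
      using that[of "x + k" "x + \<eta>" "y - \<eta>" "y - k"] k \<eta> xy m(2) e by force
  next
    case True
    then obtain r where r: "x < r" "r < y" "f r = f x" by blast
    \<comment> \<open>Otherwise \<open>x\<close> would be a local minimum with the same value as the
      one at \<open>r\<close>. Cutting \<open>{x..r}\<close> at its thirds separates the two
      neighbourhoods.\<close>
    have left: "\<exists>a. 0 \<le> a \<and> x - e < a \<and> a < x \<and> f a < f x" if "0 < x"
    proof (rule ccontr)
      assume n: "\<not> ?thesis"
      define a where "a = max 0 (x - e)"
      have "f x \<le> f s" if s: "a < s" "s < x + (r - x) / 3" for s
      proof (cases "s < x")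
        case True
        then have "\<not> f s < f x" using n s by (auto simp: a_def)
        then show ?thesis by simp
      next
        case False
        then show ?thesis using min[of s] s r by (simp add: field_simps)
      qed
      then have "f x \<noteq> f r"
        using that r xy min e
        by (intro local_minima_neq[of a x "x + (r - x) / 3" "x + (r - x) * 2 / 3" r y])
           (auto simp: a_def field_simps)
      with r show False by simp
    qed
    have right: "\<exists>b. b \<le> 1 \<and> b < y + e \<and> y < b \<and> f b < f y" if "y < 1"
    proof (rule ccontr)
      assume n: "\<not> ?thesis"
      define b where "b = min 1 (y + e)"
      have "f y \<le> f s" if s: "r + (y - r) * 2 / 3 < s" "s < b" for s
      proof (cases "y < s")
        case True
        then have "\<not> f s < f y" using n s by (auto simp: b_def)
        then show ?thesis by simp
      next
        case False
        then show ?thesis using min[of s] s r fxy by (simp add: field_simps)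
      qed
      then have "f r \<noteq> f y"
        using that r xy min e
        by (intro local_minima_neq[of x r "r + (y - r) / 3" "r + (y - r) * 2 / 3" y b])
           (auto simp: b_def field_simps)
      with r fxy show False by simp
    qed
    \<comment> \<open>At \<open>x = 0\<close> the common value is 0 and \<open>f\<close> takes no
      smaller one; this forces \<open>y = 1\<close>, which \<open>ne\<close> excludes.\<close>
    have "0 < x"
    proof (rule ccontr)
      assume "\<not> 0 < x"
      then have x: "x = 0" using xy by simp
      then obtain b where "b \<le> 1" "y < b" "f b < f y" using right ne xy by force
      then show False using f_nonneg[of b] f_ends x fxy xy by simp
    qed
    then obtain a where a: "0 \<le> a" "x - e < a" "a < x" "f a < f x" using left by blast
    then have "0 < f y" using f_nonneg[of a] xy fxy by simp
    then have "y \<noteq> 1" using f_ends by auto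
    then obtain b where b: "b \<le> 1" "b < y + e" "y < b" "f b < f y" using right xy by force
    \<comment> \<open>\<open>b\<close> may be 1, whereas the index of \<open>b0\<close> must stay
      below \<open>n\<close> to be that of a vertex; so \<open>b\<close> is moved slightly to the
      left.\<close>
    obtain b0 where "y < b0" "b0 < b" "f b0 < f y"
    proof -
      obtain d where d: "d > 0" "\<And>r. r \<in> {0..1} \<Longrightarrow> \<bar>r - b\<bar> < d \<Longrightarrow> f r < f y"
        using less_near[OF _ b(4)] b xy by auto
      define b0 where "b0 = max ((y + b) / 2) (b - d / 2)"
      have "y < b0" "b0 < b" "\<bar>b0 - b\<bar> < d" using b d by (auto simp: b0_def max_def field_simps)
      then show thesis using that[of b0] d(2)[of b0] b xy by auto
    qed
    then show thesis
      using that[of a x y b0] a b xy e fxy min \<open>x < y\<close> by force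
  qed
qed

end

section \<open>Lipschitz estimates for points and chords\<close>

lemma dist_circ_le: "dist (circ s) (circ t) \<le> 2 * pi * \<bar>s - t\<bar>"
proof -
  have "circ s - circ t = circ t * (exp (\<i> * of_real (2 * pi * (t - s))) - 1)"
    by (simp add: circ_def algebra_simps flip: exp_add)
  then have "dist (circ s) (circ t) = cmod (exp (\<i> * of_real (2 * pi * (t - s))) - 1)"
    by (simp add: dist_norm norm_mult)
  also have "\<dots> \<le> \<bar>2 * pi * (t - s)\<bar>"
    using abs_sin_x_le_abs_x[of "2 * pi * (t - s) / 2"] by (simp only: dist_exp_i_1)
  finally show ?thesis by (simp add: abs_mult abs_minus_commute)
qed

lemma closed_segment_near:
  fixes a b a' b' :: "'a::real_normed_vector"
  assumes "x \<in> closed_segment a b"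
  obtains y where "y \<in> closed_segment a' b'" "dist x y \<le> dist a a' + dist b b'"
proof -
  obtain u where u: "0 \<le> u" "u \<le> 1" "x = (1 - u) *\<^sub>R a + u *\<^sub>R b"
    using assms by (auto simp: closed_segment_def)
  define y where "y = (1 - u) *\<^sub>R a' + u *\<^sub>R b'"
  have "x - y = (1 - u) *\<^sub>R (a - a') + u *\<^sub>R (b - b')" by (simp add: u y_def algebra_simps)
  then have "dist x y \<le> (1 - u) * dist a a' + u * dist b b'"
    using norm_triangle_ineq[of "(1 - u) *\<^sub>R (a - a')" "u *\<^sub>R (b - b')"] u(1,2) by (simp add: dist_norm)
  also have "\<dots> \<le> 1 * dist a a' + 1 * dist b b'"
    using u by (intro add_mono mult_right_mono) auto
  finally show thesis using that[of y] u by (auto simp: y_def closed_segment_def)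
qed

section \<open>Approximation of the lamination by the trees\<close>

text \<open>Carries bounds on \<open>f\<close> over a real interval to all indices between its ends.
  The point is \<open>i / n\<close>, or \<open>p\<close> if \<open>i / n\<close> does not lie to the
  right of \<open>p\<close>.\<close>

lemma floor_index_exists:
  fixes p q :: real
  assumes "0 < n" "0 \<le> p" "p \<le> q" "nat \<lfloor>real n * p\<rfloor> \<le> i" "i \<le> nat \<lfloor>real n * q\<rfloor>"
  obtains r where "r \<in> {p..q}" "nat \<lfloor>real n * r\<rfloor> = i"
proof (cases "real i \<le> real n * p")
  case True
  then have "int i \<le> \<lfloor>real n * p\<rfloor>" by (simp add: le_floor_iff)
  then show thesis using that[of p] assms by auto
next
  case False
  have "int i \<le> \<lfloor>real n * q\<rfloor>" using assms by (simp add: le_nat_iff)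
  then have "real i \<le> real n * q" by (simp add: le_floor_iff)
  then show thesis using that[of "real i / real n"] False assms by (simp add: field_simps)
qed

lemma floor_index_less:
  fixes p q :: real
  assumes "0 \<le> p" "real n * p + 1 + real k \<le> real n * q"
  shows "nat \<lfloor>real n * p\<rfloor> + k < nat \<lfloor>real n * q\<rfloor>"
proof -
  have "real (nat \<lfloor>real n * p\<rfloor>) \<le> real n * p" using assms by simp
  moreover have "real n * q < real (nat \<lfloor>real n * q\<rfloor>) + 1"
    using assms by (smt (verit) of_nat_nat real_of_int_floor_add_one_gt of_nat_0_le_iff mult_nonneg_nonneg zero_le_floor of_int_of_nat_eq)
  ultimately have "real (nat \<lfloor>real n * p\<rfloor> + k) < real (nat \<lfloor>real n * q\<rfloor>)"
    unfolding of_nat_add using assms(2) by linarith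
  then show ?thesis by linarith
qed

locale coded_trees = lamination_coding +
  fixes \<theta> :: "nat \<Rightarrow> nat set set" and B :: "nat \<Rightarrow> real"
  assumes tree: "\<And>n. n \<ge> 1 \<Longrightarrow> noncrossing_tree n (\<theta> n)"
    and height: "(\<lambda>n. real (height (shape (\<theta> n))) / real n) \<longlonglongrightarrow> 0"
    and B: "filterlim B at_top sequentially"
    and path: "uniform_limit {0..1}
        (\<lambda>n s. real_of_int (lukasiewicz (shape (\<theta> n)) (nat \<lfloor>real n * s\<rfloor>)) / B n) f sequentially"
begin

abbreviation W :: "nat \<Rightarrow> nat \<Rightarrow> real" where
  "W n j \<equiv> real_of_int (lukasiewicz (shape (\<theta> n)) j)"

abbreviation H :: "nat \<Rightarrow> nat" where
  "H n \<equiv> height (shape (\<theta> n))"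

lemma eventually_path:
  assumes "\<eta> > 0"
  shows "\<forall>\<^sub>F n in sequentially. B n > 0 \<and>
    (\<forall>s\<in>{0..1}. \<bar>W n (nat \<lfloor>real n * s\<rfloor>) - B n * f s\<bar> \<le> \<eta> * B n)"
proof -
  have "\<forall>\<^sub>F n in sequentially. B n > 0"
    using B by (auto simp: filterlim_at_top_dense)
  moreover have "\<forall>\<^sub>F n in sequentially. \<forall>s\<in>{0..1}. dist (W n (nat \<lfloor>real n * s\<rfloor>) / B n) (f s) < \<eta>"
    using path assms by (rule uniform_limitD)
  ultimately show ?thesis
  proof eventually_elim
    case (elim n)
    have "\<bar>W n (nat \<lfloor>real n * s\<rfloor>) - B n * f s\<bar> \<le> \<eta> * B n" if "s \<in> {0..1}" for s
    proof -
      have "W n (nat \<lfloor>real n * s\<rfloor>) - B n * f s = B n * (W n (nat \<lfloor>real n * s\<rfloor>) / B n - f s)"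
        using elim(1) by (simp add: field_simps)
      then have "\<bar>W n (nat \<lfloor>real n * s\<rfloor>) - B n * f s\<bar> = B n * \<bar>W n (nat \<lfloor>real n * s\<rfloor>) / B n - f s\<bar>"
        using elim(1) by (simp add: abs_mult)
      also have "\<dots> \<le> B n * \<eta>"
        using elim that by (intro mult_left_mono) (auto simp: dist_real_def intro: less_imp_le)
      finally show ?thesis by (simp add: mult.commute)
    qed
    with elim(1) show ?case by blast
  qed
qed

lemma eventually_height:
  assumes "\<eta> > 0"
  shows "\<forall>\<^sub>F n in sequentially. real (H n) + 2 \<le> \<eta> * real n"
proof -
  have "\<forall>\<^sub>F n in sequentially. dist (real (H n) / real n) 0 < \<eta> / 2"
    by (rule tendstoD[OF height]) (use assms in simp)
  moreover have "\<forall>\<^sub>F n in sequentially. 4 / \<eta> < real n"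
    using filterlim_real_sequentially by (auto simp: filterlim_at_top_dense)
  ultimately show ?thesis
  proof eventually_elim
    case (elim n)
    have "0 < 4 / \<eta>" using assms by simp
    then have n: "0 < real n" using elim(2) by linarith
    then have "real (H n) \<le> \<eta> / 2 * real n" using elim(1) by (simp add: dist_real_def field_simps)
    moreover have "2 \<le> \<eta> / 2 * real n" using elim(2) assms by (simp add: field_simps)
    ultimately show ?case by (simp add: field_simps)
  qed
qed

lemma rooted_tree: "n \<ge> 1 \<Longrightarrow> rooted_tree n (\<theta> n)"
  using tree[of n] by (simp add: rooted_tree_def noncrossing_tree_def)

lemma labelled_tree: "n \<ge> 1 \<Longrightarrow> labelled_tree (shape (\<theta> n)) (rooted_tree.lab (\<theta> n))"
  using rooted_tree.labelled_tree_shape[OF rooted_tree tree] by blast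

text \<open>A degree is a jump of the path plus 1. Each quarter \<open>e\<close> of
  \<open>\<eta>\<close> pays for one term: two approximations of the path, the variation of
  \<open>f\<close> over \<open>1 / n\<close>, and the 1, absorbed since \<open>B n\<close> tends to
  infinity.\<close>

lemma eventually_num_children:
  assumes "\<eta> > 0"
  shows "\<forall>\<^sub>F n in sequentially. \<forall>u\<in>shape (\<theta> n). real (num_children (shape (\<theta> n)) u) \<le> \<eta> * B n"
proof -
  define e where "e = \<eta> / 4"
  have e: "e > 0" using assms by (simp add: e_def)
  have "uniformly_continuous_on {0..1} f"
    using f_cont by (rule compact_uniformly_continuous) simp
  then obtain d where d: "d > 0"
    "\<And>s t. s \<in> {0..1} \<Longrightarrow> t \<in> {0..1} \<Longrightarrow> dist t s < d \<Longrightarrow> dist (f t) (f s) < e"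
    using e unfolding uniformly_continuous_on_def by metis
  have "\<forall>\<^sub>F n in sequentially. 1 / e \<le> B n" using B by (simp add: filterlim_at_top)
  moreover have "\<forall>\<^sub>F n in sequentially. 1 / d < real n"
    using filterlim_real_sequentially by (auto simp: filterlim_at_top_dense)
  ultimately show ?thesis using eventually_path[OF e] eventually_ge_at_top[of 1]
  proof eventually_elim
    case (elim n)
    interpret rooted_tree n "\<theta> n" by (rule rooted_tree) (rule elim(4))
    show ?case
    proof
      fix u assume u: "u \<in> shape (\<theta> n)"
      then obtain j where j: "j < card (shape (\<theta> n))" "dfs_vertex (shape (\<theta> n)) j = u"
        using dfs_vertex_surj by blast
      then have jn: "j < n" by (simp add: card_shape)
      define s t where "s = real j / real n" and "t = real (Suc j) / real n"
      have st: "s \<in> {0..1}" "t \<in> {0..1}" using jn by (auto simp: s_def t_def)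
      have fl: "nat \<lfloor>real n * s\<rfloor> = j" "nat \<lfloor>real n * t\<rfloor> = Suc j"
      proof -
        have "real n * s = real j" "real n * t = real (Suc j)" using jn by (auto simp: s_def t_def)
        then show "nat \<lfloor>real n * s\<rfloor> = j" "nat \<lfloor>real n * t\<rfloor> = Suc j" by (metis floor_of_nat nat_int)+
      qed
      have "t - s = 1 / real n" by (simp add: s_def t_def diff_divide_distrib[symmetric])
      moreover have "1 / real n < d" using elim(2) d(1) jn by (simp add: field_simps)
      ultimately have "dist t s < d" by (simp add: dist_real_def)
      then have "f t - f s \<le> e" using d(2)[OF st] by (auto simp: dist_real_def)
      then have "B n * (f t - f s) \<le> B n * e" using elim(3) by (intro mult_left_mono) auto
      moreover have "\<bar>W n j - B n * f s\<bar> \<le> e * B n" "\<bar>W n (Suc j) - B n * f t\<bar> \<le> e * B n"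
        using elim(3) st fl by metis+
      moreover have "W n (Suc j) = W n j + real (num_children (shape (\<theta> n)) u) - 1"
        using j by simp
      moreover have "1 \<le> e * B n" using elim(1) e by (simp add: field_simps)
      ultimately have "real (num_children (shape (\<theta> n)) u) \<le> 4 * (e * B n)"
        by (simp add: algebra_simps abs_le_iff)
      then show "real (num_children (shape (\<theta> n)) u) \<le> \<eta> * B n" by (simp add: e_def)
    qed
  qed
qed

text \<open>For an edge from \<open>v\<close> to a child, the vertices \<open>w\<close> and
  \<open>c\<close> given by \<open>lab_near_dfs_index\<close> both lie in the subtree of
  \<open>v\<close>, and so does everything between them. There the path is at least its value at
  \<open>v\<close>, which it nearly attains at \<open>w\<close> and \<open>c\<close>.\<close>

lemma edges_near_coded_pairs:
  assumes "e > 0"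
  shows "\<forall>\<^sub>F n in sequentially. \<forall>p q. {p, q} \<in> \<theta> n \<longrightarrow>
    (\<exists>(s, t)\<in>coded_pairs f. \<bar>real p / real n - s\<bar> < e \<and> \<bar>real q / real n - t\<bar> < e)"
proof -
  obtain d where d: "d > 0" "\<And>s t. s \<in> {0..1} \<Longrightarrow> t \<in> {0..1} \<Longrightarrow>
       (\<And>r. r \<in> {min s t..max s t} \<Longrightarrow> f s \<le> f r + d \<and> f t \<le> f r + d) \<Longrightarrow>
       \<exists>(s', t')\<in>coded_pairs f. \<bar>s - s'\<bar> < e / 2 \<and> \<bar>t - t'\<bar> < e / 2"
    using almost_coded_pairs[OF f_cont, of "e / 2"] assms by auto
  \<comment> \<open>Four errors: two approximations of the path by \<open>f\<close>, and the degrees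
    of \<open>v\<close> and of its child.\<close>
  define \<eta> where "\<eta> = d / 4"
  have \<eta>: "\<eta> > 0" using d by (simp add: \<eta>_def)
  have "e / 2 > 0" using assms by simp
  from eventually_path[OF \<eta>] eventually_num_children[OF \<eta>] eventually_height[OF this]
    eventually_ge_at_top[of "1::nat"]
  show ?thesis
  proof eventually_elim
    case (elim n)
    interpret rooted_tree n "\<theta> n" by (rule rooted_tree) (rule elim(4))
    interpret labelled_tree \<tau> lab by (rule labelled_tree) (rule elim(4))
    have Bn: "B n > 0" using elim(1) by simp
    have near: "\<bar>real a / real n - real b / real n\<bar> \<le> e / 2"
      if "a \<le> b + H n + 2" "b \<le> a + H n + 2" for a b
    proof -
      have "\<bar>real a - real b\<bar> \<le> real (H n) + 2" using that by linarith
      then have "\<bar>real a - real b\<bar> \<le> e / 2 * real n" using elim(3) by linarith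
      moreover have "\<bar>real a / real n - real b / real n\<bar> = \<bar>real a - real b\<bar> / real n"
        by (simp add: diff_divide_distrib[symmetric])
      ultimately show ?thesis using elim(4) by (simp add: field_simps)
    qed
    have main: "\<exists>(s, t)\<in>coded_pairs f. \<bar>real (lab v) / real n - s\<bar> < e \<and> \<bar>real (lab (v @ [i])) / real n - t\<bar> < e"
      if vi: "v @ [i] \<in> \<tau>" for v i
    proof -
      have v: "v \<in> \<tau>" using vi snoc_in_tree by blast
      obtain w where w: "w \<in> \<tau>" "prefix v w" "card (pending w) \<le> card (pending v) + num_children \<tau> v"
        "lab v \<le> dfs_index w + H n + 2" "dfs_index w \<le> lab v + H n + 2"
        by (rule lab_near_dfs_index[OF v])
      obtain c where c: "c \<in> \<tau>" "prefix (v @ [i]) c"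
        "card (pending c) \<le> card (pending (v @ [i])) + num_children \<tau> (v @ [i])"
        "lab (v @ [i]) \<le> dfs_index c + H n + 2" "dfs_index c \<le> lab (v @ [i]) + H n + 2"
        by (rule lab_near_dfs_index[OF vi])
      have vc: "prefix v c" using c(2) append_prefixD by blast
      have jn: "dfs_index w < n" "dfs_index c < n" using dfs_index_less w c card_shape by auto
      define s t where "s = real (dfs_index w) / real n" and "t = real (dfs_index c) / real n"
      have st: "s \<in> {0..1}" "t \<in> {0..1}" using jn by (auto simp: s_def t_def)
      have ns: "real n * s = real (dfs_index w)" "real n * t = real (dfs_index c)"
        using jn by (auto simp: s_def t_def)
      then have fl: "nat \<lfloor>real n * s\<rfloor> = dfs_index w" "nat \<lfloor>real n * t\<rfloor> = dfs_index c" by simp_all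
      have kv: "real (num_children \<tau> v) \<le> \<eta> * B n" "real (num_children \<tau> (v @ [i])) \<le> \<eta> * B n"
        using elim(2) v vi by auto
      have ub: "W n (dfs_index w) \<le> card (pending v) + 2 * (\<eta> * B n)"
        "W n (dfs_index c) \<le> card (pending v) + 2 * (\<eta> * B n)"
        using lukasiewicz_dfs_index[OF w(1)] lukasiewicz_dfs_index[OF c(1)] w(3) c(3)
          card_pending_child[of v i] kv by auto
      have "f s \<le> f r + d \<and> f t \<le> f r + d" if r: "r \<in> {min s t..max s t}" for r
      proof -
        define m where "m = nat \<lfloor>real n * r\<rfloor>"
        have r01: "r \<in> {0..1}" using r st by (auto simp: min_def max_def split: if_splits)
        have "real n * min s t \<le> real n * r" "real n * r \<le> real n * max s t"
          using r by (auto intro: mult_left_mono)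
        moreover have "real n * min s t = real (min (dfs_index w) (dfs_index c))"
          "real n * max s t = real (max (dfs_index w) (dfs_index c))"
          using ns jn by (auto simp: min_def max_def s_def t_def divide_le_cancel)
        moreover have "real m \<le> real n * r" using r01 by (simp add: m_def)
        ultimately have m: "min (dfs_index w) (dfs_index c) \<le> m" "m \<le> max (dfs_index w) (dfs_index c)"
          unfolding m_def by (simp_all add: le_nat_floor, linarith)
        have m_less: "m < card \<tau>" using m(2) dfs_index_less[OF w(1)] dfs_index_less[OF c(1)] by auto
        let ?u = "dfs_vertex \<tau> m"
        have "v \<le> w" "v \<le> c" using w(2) vc prefix_imp_le by auto
        have "v \<le> ?u"
          using dfs_vertex_mono[OF m(1) m_less] dfs_vertex_dfs_index w c \<open>v \<le> w\<close> \<open>v \<le> c\<close>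
          by (auto simp: min_def split: if_splits)
        moreover have "?u \<le> w \<or> ?u \<le> c"
          using dfs_vertex_mono[OF m(2)] dfs_index_less[OF w(1)] dfs_index_less[OF c(1)]
            dfs_vertex_dfs_index[OF w(1)] dfs_vertex_dfs_index[OF c(1)]
          by (cases "dfs_index w \<le> dfs_index c") (auto simp: max_def)
        ultimately have "prefix v ?u" using prefix_between w(2) vc by blast
        then have "card (pending v) \<le> card (pending ?u)"
          by (intro card_mono pending_mono_prefix) auto
        then have lb: "real (card (pending v)) \<le> W n m"
          using lukasiewicz_eq_pending[OF m_less] by simp
        have close: "\<bar>W n m - B n * f r\<bar> \<le> \<eta> * B n" "\<bar>W n (dfs_index w) - B n * f s\<bar> \<le> \<eta> * B n"
          "\<bar>W n (dfs_index c) - B n * f t\<bar> \<le> \<eta> * B n"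
          using elim(1) r01 st fl m_def by metis+
        have "B n * f s \<le> B n * f r + 4 * (\<eta> * B n)" "B n * f t \<le> B n * f r + 4 * (\<eta> * B n)"
          using close ub lb by linarith+
        then have "B n * f s \<le> B n * (f r + d)" "B n * f t \<le> B n * (f r + d)"
          by (simp_all add: \<eta>_def algebra_simps)
        then show ?thesis using Bn by simp
      qed
      then obtain s' t' where st': "(s', t') \<in> coded_pairs f" "\<bar>s - s'\<bar> < e / 2" "\<bar>t - t'\<bar> < e / 2"
        using d(2)[OF st] by blast
      have "\<bar>real (lab v) / real n - s\<bar> \<le> e / 2" "\<bar>real (lab (v @ [i])) / real n - t\<bar> \<le> e / 2"
        unfolding s_def t_def using near w(4,5) c(4,5) by auto
      then have "\<bar>real (lab v) / real n - s'\<bar> < e" "\<bar>real (lab (v @ [i])) / real n - t'\<bar> < e"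
        using st'(2,3) by linarith+
      then show ?thesis using st'(1) by blast
    qed
    show ?case
    proof (intro allI impI)
      fix p q assume "{p, q} \<in> \<theta> n"
      then obtain v i where vi: "v @ [i] \<in> \<tau>" "{p, q} = {lab v, lab (v @ [i])}" by (rule edge_words)
      from main[OF vi(1)] obtain s t where st: "(s, t) \<in> coded_pairs f"
        "\<bar>real (lab v) / real n - s\<bar> < e" "\<bar>real (lab (v @ [i])) / real n - t\<bar> < e" by blast
      from vi(2) consider "p = lab v" "q = lab (v @ [i])" | "q = lab v" "p = lab (v @ [i])"
        by (auto simp: doubleton_eq_iff)
      then show "\<exists>(s, t)\<in>coded_pairs f. \<bar>real p / real n - s\<bar> < e \<and> \<bar>real q / real n - t\<bar> < e"
        using st coded_pairs_commute by cases blast+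
    qed
  qed
qed

lemma dominated_edge:
  assumes "0 \<le> a0" "a0 < a" "a \<le> b" "b < b0" "b0 < 1"
    and less: "\<And>r. r \<in> {a..b} \<Longrightarrow> f a0 < f r \<and> f b0 < f r"
    and "e > 0"
  shows "\<forall>\<^sub>F n in sequentially. \<exists>p q. {p, q} \<in> \<theta> n \<and>
    a0 - e \<le> real p / real n \<and> real p / real n \<le> a \<and> b - e \<le> real q / real n \<and> real q / real n \<le> b0"
proof -
  have cont: "continuous_on {a0..b0} f" by (rule continuous_on_subset[OF f_cont]) (use assms in auto)
  obtain a1 a2 b1 g where g: "g > 0" "a0 < a1" "a1 < a2" "a2 < a" "b < b1" "b1 < b0"
    and gap1: "\<And>r. r \<in> {a1..b1} \<Longrightarrow> f a0 + g \<le> f r \<and> f b0 + g \<le> f r"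
    and gap2: "\<And>r. r \<in> {a..b} \<Longrightarrow> f a2 + g \<le> f r \<and> f b1 + g \<le> f r"
    using two_levels[OF cont assms(2-4) less] by metis
  \<comment> \<open>Two approximations and the degree bound \<open>K\<close> cost three times
    \<open>\<eta> * B n\<close>; the fourth makes the inequality strict.\<close>
  define \<eta> where "\<eta> = g / 4"
  have \<eta>: "\<eta> > 0" using g by (simp add: \<eta>_def)
  \<comment> \<open>Once \<open>H n + 2 \<le> k * n\<close>, the indices of points at distance at
    least \<open>k\<close> differ by more than the height. The entry \<open>1 - b0\<close> keeps the
    index of \<open>b0\<close> below \<open>n\<close>, and \<open>e\<close> bounds the error on the
    labels.\<close>
  define k where "k = Min {a1 - a0, a2 - a1, a - a2, b1 - b, b0 - b1, 1 - b0, e}"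
  have k: "k > 0"
    unfolding k_def using g assms by (subst Min_gr_iff) auto
  have k_le: "k \<le> a1 - a0" "k \<le> a2 - a1" "k \<le> a - a2" "k \<le> b1 - b" "k \<le> b0 - b1" "k \<le> 1 - b0" "k \<le> e"
    unfolding k_def by (rule Min_le; simp)+
  from eventually_path[OF \<eta>] eventually_num_children[OF \<eta>] eventually_height[OF k]
    eventually_ge_at_top[of "1::nat"]
  show ?thesis
  proof eventually_elim
    case (elim n)
    interpret rooted_tree n "\<theta> n" by (rule rooted_tree) (rule elim(4))
    interpret labelled_tree \<tau> lab by (rule labelled_tree) (rule elim(4))
    define I where "I s = nat \<lfloor>real n * s\<rfloor>" for s
    have n: "0 < n" and Bn: "B n > 0" using elim by auto
    have step: "I s + (H n + 1) < I t" if "0 \<le> s" "k \<le> t - s" for s t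
    proof -
      have "k * real n \<le> (t - s) * real n" using that n by (intro mult_right_mono) auto
      then have "real n * s + 1 + real (H n + 1) \<le> real n * t" using elim(3) by (simp add: algebra_simps)
      then show ?thesis unfolding I_def using that(1) by (intro floor_index_less) auto
    qed
    have I_le: "real (I s) \<le> real n * s" and I_gt: "real n * s < real (I s) + 1" if "0 \<le> s" for s
      using that unfolding I_def by (auto simp: floor_correct intro: le_less_trans)
    have close: "\<bar>W n (I s) - B n * f s\<bar> \<le> \<eta> * B n" if "s \<in> {0..1}" for s
      using elim(1) that by (simp add: I_def)
    define K where "K = nat \<lfloor>\<eta> * B n\<rfloor>"
    have K: "num_children \<tau> u \<le> K" if "u \<in> \<tau>" for u
      using elim(2) that by (auto simp: K_def le_nat_floor)
    have K_le: "real K \<le> \<eta> * B n" using \<eta> Bn by (simp add: K_def)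
    have gap: "lukasiewicz \<tau> (I x) + int K < lukasiewicz \<tau> i"
      if i: "i \<in> {I p..I q}" and x: "x \<in> {0..1}" and pq: "0 \<le> p" "p \<le> q" "q \<le> 1"
        and fx: "\<And>r. r \<in> {p..q} \<Longrightarrow> f x + g \<le> f r" for i x p q
    proof -
      obtain r where r: "r \<in> {p..q}" "I r = i"
        using floor_index_exists[OF n pq(1,2), of i] i unfolding I_def by auto
      have "B n * (f x + g) \<le> B n * f r" using fx[OF r(1)] Bn by (intro mult_left_mono) auto
      then have "B n * f x + 4 * (\<eta> * B n) \<le> B n * f r" by (simp add: \<eta>_def algebra_simps)
      moreover have "\<bar>W n i - B n * f r\<bar> \<le> \<eta> * B n" using close[of r] r pq by auto
      moreover have "\<eta> * B n > 0" using \<eta> Bn by simp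
      ultimately have "W n (I x) + real K < W n i" using close[OF x] K_le by linarith
      then show ?thesis by linarith
    qed
    have I_mono: "I s \<le> I t" if "s \<le> t" for s t
      unfolding I_def using that by (intro nat_mono floor_mono mult_left_mono) auto
    have idx: "I a0 < I a1" "I a1 + height \<tau> < I a2" "I a2 < I a" "I a \<le> I b" "I b < I b1" "I b1 \<le> I b1" "I b1 < I b0"
      using step[of a0 a1] step[of a1 a2] step[of a2 a] step[of b b1] step[of b1 b0] I_mono[of a b]
        k_le assms(1-5) g by auto
    have "I b0 < I 1" using step[of b0 1] k_le assms by simp
    then have last: "I b0 < card \<tau>" by (simp add: card_shape I_def)
    obtain v i p q where e: "v @ [i] \<in> \<tau>" "{p, q} = {lab v, lab (v @ [i])}"
      "I a0 \<le> p + height \<tau> + 1" "p \<le> I a" "I b \<le> q + height \<tau> + 1" "q \<le> I b0"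
    proof (rule edge_across[OF idx last, of K])
      show "num_children \<tau> u \<le> K" if "u \<in> \<tau>" for u using K that .
      show "lukasiewicz \<tau> (I a0) + int K < lukasiewicz \<tau> i \<and> lukasiewicz \<tau> (I b0) + int K < lukasiewicz \<tau> i"
        if "i \<in> {I a1..I b1}" for i
        using gap[OF that, of a0] gap[OF that, of b0] gap1 g assms(1-5) by auto
      show "lukasiewicz \<tau> (I a2) + int K < lukasiewicz \<tau> i \<and> lukasiewicz \<tau> (I b1) + int K < lukasiewicz \<tau> i"
        if "i \<in> {I a..I b}" for i
        using gap[OF that, of a2] gap[OF that, of b1] gap2 g assms(1-5) by auto
    qed
    have "{p, q} \<in> \<theta> n" using edge_of_words[OF e(1)] e(2) by simp
    moreover have "a0 - e \<le> real p / real n" "b - e \<le> real q / real n"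
    proof -
      have *: "s - e \<le> real j / real n" if "I s \<le> j + H n + 1" "0 \<le> s" for s j
      proof -
        have "real n * s \<le> real j + (real (H n) + 2)" using I_gt[OF that(2)] that(1) by linarith
        also have "\<dots> \<le> real j + e * real n"
          using elim(3) mult_right_mono[OF k_le(7), of "real n"] by simp
        finally show ?thesis using n by (simp add: field_simps)
      qed
      show "a0 - e \<le> real p / real n" "b - e \<le> real q / real n" using *[of a0 p] *[of b q] e assms by auto
    qed
    moreover have "real p / real n \<le> a" "real q / real n \<le> b0"
    proof -
      have *: "real j / real n \<le> s" if "j \<le> I s" "0 \<le> s" for s j
        using I_le[OF that(2)] that(1) n by (simp add: field_simps)
      show "real p / real n \<le> a" "real q / real n \<le> b0" using *[of p a] *[of q b0] e assms by auto
    qed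
    ultimately show ?case by blast
  qed
qed

lemma vertex_near:
  assumes "x \<in> {0..1}" "e > 0"
  shows "\<forall>\<^sub>F n in sequentially. \<exists>p<n. dist (circ x) (vertex_point n p) \<le> e"
proof -
  \<comment> \<open>\<open>circ 1 = circ 0\<close>, and \<open>y < 1\<close> is needed for the floor
    to be a label below \<open>n\<close>.\<close>
  define y where "y = (if x = 1 then 0 else x)"
  have y: "0 \<le> y" "y < 1" "circ y = circ x" using assms(1) by (auto simp: y_def circ_eq_cis cis.ctr)
  have "\<forall>\<^sub>F n in sequentially. 2 * pi / e \<le> real n"
    using filterlim_real_sequentially by (simp add: filterlim_at_top)
  then show ?thesis using eventually_ge_at_top[of "1::nat"]
  proof eventually_elim
    case (elim n)
    define p where "p = nat \<lfloor>real n * y\<rfloor>"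
    have p: "real p \<le> real n * y" "real n * y < real p + 1"
      using y unfolding p_def by (auto intro: le_less_trans)
    have "real n * y < real n * 1" using y elim(2) by (intro mult_strict_left_mono) auto
    then have "p < n" using p by simp
    have "y - real p / real n = (real n * y - real p) / real n" using elim(2) by (simp add: field_simps)
    then have "\<bar>y - real p / real n\<bar> = (real n * y - real p) / real n" using p(1) by simp
    also have "\<dots> \<le> 1 / real n" using p by (intro divide_right_mono) auto
    finally have "dist (circ y) (circ (real p / real n)) \<le> 2 * pi * (1 / real n)"
      using dist_circ_le[of y "real p / real n"] mult_left_mono[of _ "1 / real n" "2 * pi"] by fastforce
    also have "\<dots> \<le> e" using elim assms(2) by (simp add: field_simps)
    finally show ?case using \<open>p < n\<close> y(3) by (auto simp: vertex_point_def)
  qed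
qed

text \<open>The case \<open>p = q\<close> serves the trivial pairs. For the others
  \<open>dominated_near\<close> supplies the points to which \<open>dominated_edge\<close>
  applies.\<close>

lemma coded_pair_near:
  assumes "(x, y) \<in> coded_pairs f" "e > 0"
  shows "\<forall>\<^sub>F n in sequentially. \<exists>p q. p < n \<and> q < n \<and> (p = q \<or> {p, q} \<in> \<theta> n) \<and>
    dist (circ x) (vertex_point n p) \<le> e \<and> dist (circ y) (vertex_point n q) \<le> e"
  using assms(1)
proof (induction x y rule: linorder_wlog)
  case (le x y)
  have xy: "x \<in> {0..1}" "y \<in> {0..1}" using le(2) by (auto simp: coded_pairs_def)
  show ?case
  proof (cases "x = y \<or> x = 0 \<and> y = 1")
    case True
    then have "circ y = circ x" by (auto simp: circ_eq_cis cis.ctr)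
    then show ?thesis
      using vertex_near[OF xy(1) assms(2)] by (auto elim!: eventually_mono)
  next
    case False
    \<comment> \<open>Of the distance \<open>2 * d\<close>, one half comes from
      \<open>dominated_near\<close> and one from \<open>dominated_edge\<close>; \<open>circ\<close>
      stretches it by at most \<open>2 * pi\<close>.\<close>
    define d where "d = e / (4 * pi)"
    have d: "d > 0" "2 * pi * (2 * d) = e" using assms(2) by (auto simp: d_def)
    obtain a0 a b b0 where ab: "0 \<le> a0" "a0 < a" "a \<le> b" "b < b0" "b0 < 1"
      "\<And>r. r \<in> {a..b} \<Longrightarrow> f a0 < f r \<and> f b0 < f r"
      "x - d < a0" "a < x + d" "y - d < b" "b0 < y + d"
      using dominated_near[OF le(2) _ _ d(1)] le(1) False by (metis order_le_less)
    have near: "dist (circ s) (vertex_point n p) \<le> e" if "\<bar>s - real p / real n\<bar> \<le> 2 * d" for s n p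
    proof -
      have "2 * pi * \<bar>s - real p / real n\<bar> \<le> 2 * pi * (2 * d)"
        using that by (intro mult_left_mono) auto
      then show ?thesis using dist_circ_le[of s "real p / real n"] d(2) by (simp add: vertex_point_def)
    qed
    have "\<forall>\<^sub>F n in sequentially. \<exists>p q. {p, q} \<in> \<theta> n \<and> a0 - d \<le> real p / real n \<and>
      real p / real n \<le> a \<and> b - d \<le> real q / real n \<and> real q / real n \<le> b0"
      by (rule dominated_edge) (use ab d in auto)
    then show ?thesis using eventually_ge_at_top[of "1::nat"]
    proof eventually_elim
      case (elim n)
      then obtain p q where e: "{p, q} \<in> \<theta> n" "a0 - d \<le> real p / real n" "real p / real n \<le> a"
        "b - d \<le> real q / real n" "real q / real n \<le> b0" by blast
      have "is_tree n (\<theta> n)" using tree[OF elim(2)] by (simp add: noncrossing_tree_def)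
      then have "p < n" "q < n" using edge_less e(1) by blast+
      moreover have "dist (circ x) (vertex_point n p) \<le> e" "dist (circ y) (vertex_point n q) \<le> e"
        by (rule near; use e ab d in \<open>simp add: abs_le_iff\<close>)+
      ultimately show ?case using e(1) by blast
    qed
  qed
next
  case (sym x y)
  from sym(1)[OF coded_pairs_commute[OF sym(2)]] show ?case
    by (rule eventually_mono) (metis insert_commute)
qed

section \<open>Compactness and the two halves of the Hausdorff distance\<close>

lemma lamination_eq_coded_pairs:
  "lamination f = (\<Union>(s, t)\<in>coded_pairs f. closed_segment (circ s) (circ t))"
  using lamination_eq f_nonneg by blast

lemma compact_lamination: "compact (lamination f)"
proof -
  define \<phi> :: "(real \<times> real) \<times> real \<Rightarrow> complex" where
    "\<phi> = (\<lambda>p. (1 - snd p) *\<^sub>R circ (fst (fst p)) + snd p *\<^sub>R circ (snd (fst p)))"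
  have "lamination f = \<phi> ` (coded_pairs f \<times> {0..1})"
    unfolding lamination_eq_coded_pairs
    by (force simp: \<phi>_def closed_segment_def image_iff)
  moreover have "continuous_on (coded_pairs f \<times> {0..1}) \<phi>"
    unfolding \<phi>_def circ_def by (intro continuous_intros)
  ultimately show ?thesis
    using compact_coded_pairs[OF f_cont] by (simp add: compact_continuous_image compact_Times)
qed

lemma closed_segment_circ_subset: "closed_segment (circ s) (circ t) \<subseteq> cball 0 1"
  by (intro closed_segment_subset) auto

lemma lamination_in_compacts: "lamination f \<in> compacts_in (cball 0 1)"
proof -
  have "(0, 0) \<in> coded_pairs f" by (simp add: coded_pairs_refl)
  then have "circ 0 \<in> lamination f" unfolding lamination_eq_coded_pairs by force
  then show ?thesis
    using compact_lamination closed_segment_circ_subset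
    unfolding compacts_in_def lamination_eq_coded_pairs by blast
qed

text \<open>For \<open>n = 1\<close> there is no edge and the figure is empty, so it is not a
  nonempty compact set; the limit only concerns \<open>n \<ge> 2\<close>.\<close>

lemma vertex_in_figure:
  assumes "2 \<le> n" "p < n"
  shows "vertex_point n p \<in> tree_figure n (\<theta> n)"
proof -
  define q where "q = (if p = 0 then 1 else 0 :: nat)"
  have "q < n" "p \<noteq> q" using assms by (auto simp: q_def)
  moreover have "is_tree n (\<theta> n)" using tree[of n] assms by (simp add: noncrossing_tree_def)
  ultimately have "(p, q) \<in> (adj (\<theta> n))\<^sup>*" using assms by (simp add: is_tree_def)
  then obtain r where "(p, r) \<in> adj (\<theta> n)" using \<open>p \<noteq> q\<close> by (auto elim: converse_rtranclE)
  then have "edge_segment n p r \<subseteq> tree_figure n (\<theta> n)" by (auto simp: adj_def tree_figure_def)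
  then show ?thesis by (auto simp: edge_segment_def)
qed

lemma figure_in_compacts:
  assumes "2 \<le> n"
  shows "tree_figure n (\<theta> n) \<in> compacts_in (cball 0 1)"
proof -
  have "is_tree n (\<theta> n)" using tree[of n] assms by (simp add: noncrossing_tree_def)
  then have "{(p, q). {p, q} \<in> \<theta> n} \<subseteq> {..<n} \<times> {..<n}" using edge_less by auto
  then have "finite {(p, q). {p, q} \<in> \<theta> n}" by (rule finite_subset) simp
  moreover have eq: "tree_figure n (\<theta> n) = (\<Union>(p, q)\<in>{(p, q). {p, q} \<in> \<theta> n}. edge_segment n p q)"
    by (auto simp: tree_figure_def)
  ultimately have "compact (tree_figure n (\<theta> n))"
    by (auto simp: edge_segment_def intro!: compact_UN)
  moreover have "tree_figure n (\<theta> n) \<subseteq> cball 0 1"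
    using closed_segment_circ_subset
    by (fastforce simp: tree_figure_def edge_segment_def vertex_point_def)
  ultimately show ?thesis using vertex_in_figure[of n 0] assms by (auto simp: compacts_in_def)
qed

lemma figure_near_lamination:
  assumes "e > 0"
  shows "\<forall>\<^sub>F n in sequentially. \<forall>x\<in>tree_figure n (\<theta> n). infdist x (lamination f) \<le> e"
proof -
  define d where "d = e / (4 * pi)"
  have d: "d > 0" "2 * pi * d = e / 2" using assms by (auto simp: d_def)
  show ?thesis using edges_near_coded_pairs[OF d(1)]
  proof eventually_elim
    case (elim n)
    show ?case
    proof
      fix x assume "x \<in> tree_figure n (\<theta> n)"
      then obtain p q where pq: "{p, q} \<in> \<theta> n" "x \<in> closed_segment (vertex_point n p) (vertex_point n q)"
        by (auto simp: tree_figure_def edge_segment_def)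
      obtain s t where st: "(s, t) \<in> coded_pairs f" "\<bar>real p / real n - s\<bar> < d" "\<bar>real q / real n - t\<bar> < d"
        using elim pq(1) by blast
      obtain y where y: "y \<in> closed_segment (circ s) (circ t)"
        "dist x y \<le> dist (vertex_point n p) (circ s) + dist (vertex_point n q) (circ t)"
        using closed_segment_near[OF pq(2)] .
      have near: "dist (vertex_point n p) (circ s) \<le> e / 2" if "\<bar>real p / real n - s\<bar> < d" for p s
      proof -
        have "2 * pi * \<bar>real p / real n - s\<bar> \<le> 2 * pi * d" using that by (intro mult_left_mono) auto
        then show ?thesis
          unfolding vertex_point_def using dist_circ_le[of "real p / real n" s] d(2) by linarith
      qed
      have "y \<in> lamination f" using y(1) st(1) unfolding lamination_eq_coded_pairs by blast
      moreover have "dist x y \<le> e" using y(2) near[OF st(2)] near[OF st(3)] by linarith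
      ultimately show "infdist x (lamination f) \<le> e" by (rule infdist_le2)
    qed
  qed
qed

text \<open>How large \<open>n\<close> must be in \<open>coded_pair_near\<close> depends on the
  pair; a finite net \<open>C\<close> of coded pairs makes it uniform. Each end of a chord costs
  \<open>e / 4\<close> for passing to the net and \<open>e / 4\<close> for passing to a
  vertex.\<close>

lemma lamination_near_figure:
  assumes "e > 0"
  shows "\<forall>\<^sub>F n in sequentially. \<forall>x\<in>lamination f. infdist x (tree_figure n (\<theta> n)) \<le> e"
proof -
  define d where "d = e / (8 * pi)"
  have d: "d > 0" "2 * pi * d = e / 4" using assms by (auto simp: d_def)
  obtain C where C: "C \<subseteq> coded_pairs f" "finite C" "coded_pairs f \<subseteq> (\<Union>c\<in>C. ball c d)"
    by (rule compactE_image[OF compact_coded_pairs[OF f_cont], of "coded_pairs f" "\<lambda>c. ball c d"])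
       (use d in auto)
  have "\<forall>\<^sub>F n in sequentially. \<forall>c\<in>C. \<exists>p q. p < n \<and> q < n \<and> (p = q \<or> {p, q} \<in> \<theta> n) \<and>
    dist (circ (fst c)) (vertex_point n p) \<le> e / 4 \<and> dist (circ (snd c)) (vertex_point n q) \<le> e / 4"
    using C assms by (intro eventually_ball_finite ballI coded_pair_near) auto
  then show ?thesis using eventually_ge_at_top[of "2::nat"]
  proof eventually_elim
    case (elim n)
    show ?case
    proof
      fix x assume "x \<in> lamination f"
      then obtain s t where st: "(s, t) \<in> coded_pairs f" "x \<in> closed_segment (circ s) (circ t)"
        unfolding lamination_eq_coded_pairs by blast
      obtain c where c: "c \<in> C" "dist c (s, t) < d" using C(3) st(1) by (auto simp: mem_ball)
      obtain p q where pq: "p < n" "q < n" "p = q \<or> {p, q} \<in> \<theta> n"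
        "dist (circ (fst c)) (vertex_point n p) \<le> e / 4" "dist (circ (snd c)) (vertex_point n q) \<le> e / 4"
        using elim(1) c(1) by blast
      obtain y where y: "y \<in> closed_segment (vertex_point n p) (vertex_point n q)"
        "dist x y \<le> dist (circ s) (vertex_point n p) + dist (circ t) (vertex_point n q)"
        using closed_segment_near[OF st(2)] .
      have "closed_segment (vertex_point n p) (vertex_point n q) \<subseteq> tree_figure n (\<theta> n)"
        using pq vertex_in_figure[OF elim(2)] by (auto simp: tree_figure_def edge_segment_def)
      then have yT: "y \<in> tree_figure n (\<theta> n)" using y(1) by blast
      have near: "dist (circ r) (circ r') \<le> e / 4" if "dist r' r < d" for r r'
      proof -
        have "2 * pi * \<bar>r - r'\<bar> \<le> 2 * pi * d"
          using that by (intro mult_left_mono) (auto simp: dist_real_def)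
        then show ?thesis using dist_circ_le[of r r'] d(2) by linarith
      qed
      have "dist (fst c) s < d" "dist (snd c) t < d"
        using c(2) dist_fst_le[of c "(s, t)"] dist_snd_le[of c "(s, t)"] by auto
      then have "dist (circ s) (circ (fst c)) \<le> e / 4" "dist (circ t) (circ (snd c)) \<le> e / 4"
        using near by blast+
      then have "dist (circ s) (vertex_point n p) \<le> e / 2" "dist (circ t) (vertex_point n q) \<le> e / 2"
        using pq(4,5) dist_triangle[of "circ s" "vertex_point n p" "circ (fst c)"]
          dist_triangle[of "circ t" "vertex_point n q" "circ (snd c)"] by linarith+
      then have "dist x y \<le> e" using y(2) by linarith
      with yT show "infdist x (tree_figure n (\<theta> n)) \<le> e" by (rule infdist_le2)
    qed
  qed
qed

lemma figure_limit:
  "limitin (hausdorff_topology (cball 0 1)) (\<lambda>n. tree_figure n (\<theta> n)) (lamination f) sequentially"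
  unfolding limitin_hausdorff_topology
proof (intro conjI lamination_in_compacts)
  show "\<forall>\<^sub>F n in sequentially. tree_figure n (\<theta> n) \<in> compacts_in (cball 0 1)"
    using eventually_ge_at_top[of "2::nat"] by eventually_elim (rule figure_in_compacts)
  show "(\<lambda>n. hausdorff_dist (tree_figure n (\<theta> n)) (lamination f)) \<longlonglongrightarrow> 0"
  proof (rule tendstoI)
    fix e :: real assume e: "e > 0"
    then have "e / 2 > 0" by simp
    from figure_near_lamination[OF this] lamination_near_figure[OF this] eventually_ge_at_top[of "2::nat"]
    show "\<forall>\<^sub>F n in sequentially. dist (hausdorff_dist (tree_figure n (\<theta> n)) (lamination f)) 0 < e"
    proof eventually_elim
      case (elim n)
      have "hausdorff_dist (tree_figure n (\<theta> n)) (lamination f) \<le> e / 2"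
        using elim figure_in_compacts[OF elim(3)] lamination_in_compacts
        by (subst hausdorff_dist_le_iff) (auto simp: compacts_in_def compact_imp_bounded)
      then show ?case using e hausdorff_dist_nonneg[of "tree_figure n (\<theta> n)" "lamination f"]
        by (simp add: dist_real_def)
    qed
  qed
qed

end

theorem proposition12:
  fixes f :: "real \<Rightarrow> real" and \<theta> :: "nat \<Rightarrow> nat set set"
  assumes f_cont: "continuous_on {0..1} f"
    and f_nonneg: "\<And>s. s \<in> {0..1} \<Longrightarrow> 0 \<le> f s"
    and f_ends: "f 0 = 0" "f 1 = 0"
    and f_minima: "distinct_local_minima f"
    and tree: "\<And>n. n \<ge> 1 \<Longrightarrow> noncrossing_tree n (\<theta> n)"
    and height: "(\<lambda>n. real (height (shape (\<theta> n))) / real n) \<longlonglongrightarrow> 0"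
    and path: "\<exists>B :: nat \<Rightarrow> real. filterlim B at_top sequentially \<and>
      uniform_limit {0..1}
        (\<lambda>n s. real_of_int (lukasiewicz (shape (\<theta> n)) (nat \<lfloor>real n * s\<rfloor>)) / B n) f sequentially"
  shows "limitin (hausdorff_topology (cball 0 1)) (\<lambda>n. tree_figure n (\<theta> n)) (lamination f) sequentially"
proof -
  from path obtain B where "filterlim B at_top sequentially" "uniform_limit {0..1}
      (\<lambda>n s. real_of_int (lukasiewicz (shape (\<theta> n)) (nat \<lfloor>real n * s\<rfloor>)) / B n) f sequentially"
    by blast
  then interpret coded_trees f \<theta> B
    using assms by unfold_locales
  show ?thesis by (rule figure_limit)
qed

end
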